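(* For every nonnegative integer $n$, $$\omega(12n+2)=12B_3(6n).$$
   Context: For an integer $n\ge 0$, $\omega(n)$ is the number of ordered tuples $(x_1,x_2,x_3,y_1,y_2,y_3)\in\mathbb{Z}^6$ with $x_1^2+x_2^2+x_3^2+3y_1^2+3y_2^2+3y_3^2=n$. A partition is a 3-core if none of its hook numbers is a multiple of 3 (the empty partition is a 3-core). For an integer $n\ge 0$, $B_3(n)$ denotes the number of partition triples of $n$ with 3-cores, i.e. ordered triples $(\lambda_1,\lambda_2,\lambda_3)$ of (possibly empty) partitions, each a 3-core, such that the sum of all the parts of $\lambda_1,\lambda_2,\lambda_3$ equals $n$; in particular $B_3(0)=1$. Equivalently (a standard fact recalled in the paper), $\sum_{n\ge 0}B_3(n)q^n=\dfrac{f_3^9}{f_1^3}$, where $f_k=\prod_{m=1}^{\infty}(1-q^{km})$. *)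

theory Defs
  imports Main
begin

definition omega :: "nat \<Rightarrow> nat" where
  "omega n = card {(x1::int, x2::int, x3::int, y1::int, y2::int, y3::int).
     x1^2 + x2^2 + x3^2 + 3 * y1^2 + 3 * y2^2 + 3 * y3^2 = int n}"

text \<open>A partition is the weakly decreasing list of its (positive) parts;
  the empty partition is the empty list.\<close>

definition is_partition :: "nat list \<Rightarrow> bool" where
  "is_partition p \<longleftrightarrow> sorted_wrt (\<ge>) p \<and> (\<forall>k \<in> set p. 0 < k)"

text \<open>The cells of the Young diagram of \<open>p\<close> are the pairs \<open>(i, j)\<close> (row, column, both counted
  from 0) with \<open>i < length p\<close> and \<open>j < p ! i\<close>. The hook number of a cell is its arm
  (cells to the right in the same row) plus its leg (cells below in the same column) plus 1
  for the cell itself.\<close>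

definition young_cells :: "nat list \<Rightarrow> (nat \<times> nat) set" where
  "young_cells p = {(i, j). i < length p \<and> j < p ! i}"

definition hook_number :: "nat list \<Rightarrow> nat \<times> nat \<Rightarrow> nat" where
  "hook_number p = (\<lambda>(i, j). card {l. j < l \<and> (i, l) \<in> young_cells p}
     + card {k. i < k \<and> (k, j) \<in> young_cells p} + 1)"

definition is_core :: "nat \<Rightarrow> nat list \<Rightarrow> bool" where
  "is_core t p \<longleftrightarrow> is_partition p \<and> (\<forall>c \<in> young_cells p. \<not> t dvd hook_number p c)"

definition B3 :: "nat \<Rightarrow> nat" where
  "B3 n = card {(p, q, r). is_core 3 p \<and> is_core 3 q \<and> is_core 3 r
     \<and> sum_list p + sum_list q + sum_list r = n}"

text \<open>Both cardinalities are those of finite sets.\<close>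

lemma finite_omega:
  "finite {(x1::int, x2::int, x3::int, y1::int, y2::int, y3::int).
     x1^2 + x2^2 + x3^2 + 3 * y1^2 + 3 * y2^2 + 3 * y3^2 = int n}" (is "finite ?S")
proof (rule finite_subset)
  let ?I = "{- int n .. int n}"
  have bound: "x \<in> ?I" if "x^2 \<le> int n" for x :: int
  proof -
    have "\<bar>x\<bar> \<le> \<bar>x\<bar> * \<bar>x\<bar>"
      using mult_left_mono[of 1 "\<bar>x\<bar>" "\<bar>x\<bar>"] by (cases "x = 0") auto
    then show ?thesis using that by (auto simp: power2_eq_square)
  qed
  show "?S \<subseteq> ?I \<times> ?I \<times> ?I \<times> ?I \<times> ?I \<times> ?I"
  proof (rule subsetI, clarify, intro conjI SigmaI)
    fix x1 x2 x3 y1 y2 y3 :: int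
    assume eq: "x1^2 + x2^2 + x3^2 + 3 * y1^2 + 3 * y2^2 + 3 * y3^2 = int n"
    note nn = zero_le_power2[of x1] zero_le_power2[of x2] zero_le_power2[of x3]
      zero_le_power2[of y1] zero_le_power2[of y2] zero_le_power2[of y3]
    show "x1 \<in> ?I" by (rule bound) (use eq nn in linarith)
    show "x2 \<in> ?I" by (rule bound) (use eq nn in linarith)
    show "x3 \<in> ?I" by (rule bound) (use eq nn in linarith)
    show "y1 \<in> ?I" by (rule bound) (use eq nn in linarith)
    show "y2 \<in> ?I" by (rule bound) (use eq nn in linarith)
    show "y3 \<in> ?I" by (rule bound) (use eq nn in linarith)
  qed
qed simp

lemma finite_partitions_le: "finite {p. is_partition p \<and> sum_list p \<le> n}"
proof (rule finite_subset)
  have len: "length p \<le> sum_list p" if "\<forall>k \<in> set p. 0 < k" for p :: "nat list"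
    using that by (induction p) auto
  show "{p. is_partition p \<and> sum_list p \<le> n} \<subseteq> {p. set p \<subseteq> {..n} \<and> length p \<le> n}"
    using len member_le_sum_list by (fastforce simp: is_partition_def intro: order_trans)
qed (simp add: finite_lists_length_le)

lemma finite_B3:
  "finite {(p, q, r). is_core 3 p \<and> is_core 3 q \<and> is_core 3 r
     \<and> sum_list p + sum_list q + sum_list r = n}" (is "finite ?S")
proof (rule finite_subset)
  let ?P = "{p. is_partition p \<and> sum_list p \<le> n}"
  show "?S \<subseteq> ?P \<times> ?P \<times> ?P" by (auto simp: is_core_def)
  show "finite (?P \<times> ?P \<times> ?P)" by (intro finite_cartesian_product finite_partitions_le)
qed

end

theory Submission
  imports Defs "HOL-Computational_Algebra.Formal_Power_Series"
begin

text \<open>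
Let \<open>w\<close> be a primitive cube root of unity and \<open>N(x + y w) = x\<^sup>2 - x y + y\<^sup>2\<close> the norm on the
Eisenstein integers \<open>\<int>[w]\<close>; put \<open>\<theta> = 1 + 2 w\<close>, so \<open>\<theta>\<^sup>2 = -3\<close> and \<open>\<int>[w]/\<theta>\<close> has three elements.
With \<open>X = q\<^sup>1\<^sup>/\<^sup>3\<close>, the Borwein theta functions \<open>a(q)\<close> and \<open>c(q)\<close> are the sums of \<open>X\<^bsup>N(z)\<^esup>\<close> over
\<open>z \<equiv> 0\<close> and over \<open>z \<equiv> 1\<close> modulo \<open>\<theta>\<close>. Write \<open>a\<^sub>k = a(q\<^sup>k)\<close>, \<open>c\<^sub>k = c(q\<^sup>k)\<close>, and \<open>m = 6 n + 1\<close>.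
Both sides of the theorem are 4 times the coefficient of \<open>X\<^sup>m\<close> in \<open>c\<^sub>1 a\<^sub>1\<^sup>2\<close>.

\<^bold>\<open>The 3-cores.\<close> The first-column hook lengths of a 3-core are \<open>1, 4, 7, \<dots>\<close> (\<open>i\<close> of them) together
with \<open>2, 5, 8, \<dots>\<close> (\<open>j\<close> of them), for arbitrary \<open>i\<close> and \<open>j\<close>; its size \<open>h = i\<^sup>2 - i j + j\<^sup>2 + j\<close> makes
\<open>3 h + 1\<close> the norm of an element congruent to 1 modulo \<open>\<theta>\<close>. As \<open>(i, j)\<close> runs through \<open>\<nat>\<^sup>2\<close> this
element runs through a third of its coset, multiplication by \<open>w\<close> producing the other two thirds.
So the coefficient of \<open>X\<^bsup>3m\<^esup>\<close> in \<open>c\<^sub>1\<^sup>3\<close> is \<open>27 B\<^sub>3(m - 1)\<close> (\<open>theta_1_cubed_cores\<close>). The discrete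
Fourier transform of order 3 multiplies the sum of three norms by 3, and it turns this coefficient
into 9 times that of \<open>X\<^sup>m\<close> in \<open>c\<^sub>1 a\<^sub>1\<^sup>2\<close> (\<open>theta_1_cubed_nth\<close>).

\<^bold>\<open>The quadratic form.\<close> Since \<open>x\<^sup>2 + 3 y\<^sup>2\<close> is the norm of \<open>x + y \<theta>\<close>, \<open>omega (2 m)\<close> counts triples in
\<open>\<int>[\<theta>]\<close> with norm sum \<open>2 m\<close>. As \<open>m\<close> is odd, exactly one of the three is divisible by 2, and passing to
half sum \<open>s\<close> and half difference \<open>d\<close> of the two others gives the number of all solutions of
\<open>N(s) + N(d) + 2 N(e) = m\<close> (\<open>omega_even\<close>): the three positions of the even entry make up for the fact
that \<open>s + d\<close> is confined to one of three classes modulo 2. Since \<open>m \<equiv> 1\<close> modulo 3, this is the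
coefficient of \<open>X\<^sup>m\<close> in \<open>4 (a\<^sub>1 a\<^sub>2 c\<^sub>1 + 2 c\<^sub>1\<^sup>2 c\<^sub>2)\<close>.

\<^bold>\<open>The link.\<close> The forms \<open>N(s) + N(d) + 2 N(e)\<close> and \<open>N(s) + 3 N(d) + 3 N(e)\<close> are not equivalent over
the rationals, so no linear change of variables relates them. What relates them is a pair of identities
between theta functions,
\<open>c\<^sub>1\<^sup>2 = c\<^sub>2 (a\<^sub>1 + 2 a\<^sub>2)\<close> and \<open>c\<^sub>1 (a\<^sub>1 - a\<^sub>2) = 2 c\<^sub>2\<^sup>2\<close> (\<open>defects_zero\<close>), from which
\<open>a\<^sub>1 a\<^sub>2 c\<^sub>1 + 2 c\<^sub>1\<^sup>2 c\<^sub>2 = c\<^sub>1 a\<^sub>1\<^sup>2 + 4 a\<^sub>2 c\<^sub>2\<^sup>2\<close> follows; the last term is even in \<open>X\<close> and does not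
contribute to \<open>X\<^sup>m\<close>. The identities are proved by descent. The map \<open>(s, d) \<mapsto> (s + d, s - d)\<close> doubles
norm sums and yields formulas for the products \<open>c\<^sub>2 a\<^sub>2\<close> and \<open>c\<^sub>2\<^sup>2\<close>; by these, \<open>c\<^sub>1 - c\<^sub>4\<close> times the
error of either identity is a combination of the errors at \<open>q\<^sup>2\<close> (\<open>descent\<close>). Replacing \<open>q\<close> by \<open>q\<^sup>2\<close>
doubles the order of vanishing, whereas \<open>c\<^sub>1 - c\<^sub>4\<close> vanishes to order 1 only, so errors of order at
least 2 must vanish to every order.
\<close>

unbundle fps_syntax

section \<open>Generating functions of weighted sets\<close>

definition gf :: "('a \<Rightarrow> int) \<Rightarrow> 'a set \<Rightarrow> int fps" where
  "gf w S = Abs_fps (\<lambda>n. int (card {x \<in> S. w x = int n}))"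

text \<open>What makes \<^term>\<open>gf w S\<close> meaningful as a formal power series \<open>\<Sum>x\<in>S. X\<^bsup>w x\<^esup>\<close>: no element has negative
weight, and no weight is taken infinitely often (an infinite fibre would be counted as 0).\<close>
definition graded :: "('a \<Rightarrow> int) \<Rightarrow> 'a set \<Rightarrow> bool" where
  "graded w S \<longleftrightarrow> (\<forall>x\<in>S. 0 \<le> w x) \<and> (\<forall>n. finite {x \<in> S. w x = n})"

lemma gf_nth: "gf w S $ n = int (card {x \<in> S. w x = int n})"
  by (simp add: gf_def)

lemma graded_subset: "graded w S \<Longrightarrow> T \<subseteq> S \<Longrightarrow> graded w T"
  unfolding graded_def by (auto elim!: finite_subset[rotated])

lemma graded_Times:
  assumes "graded w S" "graded v T"
  shows "graded (\<lambda>(x, y). w x + v y) (S \<times> T)"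
proof -
  have "finite {z \<in> S \<times> T. (case z of (x, y) \<Rightarrow> w x + v y) = n}" for n
  proof (rule finite_subset)
    show "{z \<in> S \<times> T. (case z of (x, y) \<Rightarrow> w x + v y) = n}
      \<subseteq> (\<Union>i\<in>{0..n}. {x \<in> S. w x = i} \<times> {y \<in> T. v y = n - i})"
      using assms by (force simp: graded_def)
    show "finite (\<Union>i\<in>{0..n}. {x \<in> S. w x = i} \<times> {y \<in> T. v y = n - i})"
      using assms by (auto simp: graded_def)
  qed
  then show ?thesis using assms by (auto simp: graded_def)
qed

lemma gf_mult:
  assumes "graded w S" "graded v T"
  shows "gf w S * gf v T = gf (\<lambda>(x, y). w x + v y) (S \<times> T)"
proof (rule fps_ext)
  fix n
  have "{z \<in> S \<times> T. (case z of (x, y) \<Rightarrow> w x + v y) = int n}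
      = (\<Union>i\<in>{0..n}. {x \<in> S. w x = int i} \<times> {y \<in> T. v y = int (n - i)})" (is "?L = ?R")
  proof
    show "?L \<subseteq> ?R"
    proof clarify
      fix x y assume xy: "x \<in> S" "y \<in> T" "w x + v y = int n"
      then have "0 \<le> w x" "0 \<le> v y" using assms by (auto simp: graded_def)
      then have "nat (w x) \<in> {0..n}" "w x = int (nat (w x))" "v y = int (n - nat (w x))"
        using xy by auto
      then show "(x, y) \<in> ?R" using xy by blast
    qed
    show "?R \<subseteq> ?L" by auto
  qed
  then have "card {z \<in> S \<times> T. (case z of (x, y) \<Rightarrow> w x + v y) = int n}
      = (\<Sum>i\<in>{0..n}. card ({x \<in> S. w x = int i} \<times> {y \<in> T. v y = int (n - i)}))"
    by (simp only:, intro card_UN_disjoint) (use assms in \<open>auto simp: graded_def\<close>)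
  then show "(gf w S * gf v T) $ n = gf (\<lambda>(x, y). w x + v y) (S \<times> T) $ n"
    by (simp add: fps_mult_nth gf_nth card_cartesian_product)
qed

lemma gf_bij:
  assumes "bij_betw f S T" "\<And>x. x \<in> S \<Longrightarrow> v (f x) = w x"
  shows "gf w S = gf v T"
proof (rule fps_ext)
  fix n
  have "bij_betw f {x \<in> S. w x = int n} {y \<in> T. v y = int n}"
    using assms by (auto simp: bij_betw_def inj_on_def image_iff)
  then show "gf w S $ n = gf v T $ n" by (simp add: gf_nth bij_betw_same_card)
qed

lemma gf_Un:
  assumes "graded w (S \<union> T)" "S \<inter> T = {}"
  shows "gf w (S \<union> T) = gf w S + gf w T"
proof (rule fps_ext)
  fix n
  have "{x \<in> S \<union> T. w x = int n} = {x \<in> S. w x = int n} \<union> {x \<in> T. w x = int n}" by auto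
  moreover have "finite {x \<in> S. w x = int n}" "finite {x \<in> T. w x = int n}"
    using graded_subset[OF assms(1), of S] graded_subset[OF assms(1), of T]
    by (auto simp: graded_def)
  moreover have "{x \<in> S. w x = int n} \<inter> {x \<in> T. w x = int n} = {}" using assms by auto
  ultimately show "gf w (S \<union> T) $ n = (gf w S + gf w T) $ n"
    by (simp add: gf_nth card_Un_disjoint)
qed

lemma gf_scale: "k > 0 \<Longrightarrow> gf (\<lambda>x. int k * w x) S $ (k * n) = gf w S $ n"
  by (simp add: gf_nth)

lemma gf3:
  assumes "graded u R" "graded v S" "graded w T"
  shows "gf u R * (gf v S * gf w T) = gf (\<lambda>(x, y, z). u x + (v y + w z)) (R \<times> S \<times> T)"
proof -
  have "gf u R * (gf v S * gf w T) = gf (\<lambda>(x, yz). u x + (case yz of (y, z) \<Rightarrow> v y + w z)) (R \<times> S \<times> T)"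
    using assms by (simp add: gf_mult graded_Times)
  also have "(\<lambda>(x, yz). u x + (case yz of (y, z) \<Rightarrow> v y + w z)) = (\<lambda>(x, y, z). u x + (v y + w z))"
    by auto
  finally show ?thesis .
qed

text \<open>Congruences on exponents let single terms of an expansion be discarded.\<close>
definition supported :: "int fps \<Rightarrow> nat \<Rightarrow> nat \<Rightarrow> bool" where
  "supported f r M \<longleftrightarrow> (\<forall>n. f $ n \<noteq> 0 \<longrightarrow> n mod M = r mod M)"

lemma supported_mult:
  assumes "supported f r M" "supported g s M"
  shows "supported (f * g) (r + s) M"
  unfolding supported_def
proof (intro allI impI)
  fix n assume "(f * g) $ n \<noteq> 0"
  then obtain i where i: "i \<in> {0..n}" "f $ i * g $ (n - i) \<noteq> 0"
    unfolding fps_mult_nth by (meson sum.neutral)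
  then have "i mod M = r mod M" "(n - i) mod M = s mod M"
    using assms by (auto simp: supported_def)
  then have "(i + (n - i)) mod M = (r + s) mod M" by (metis mod_add_eq)
  then show "n mod M = (r + s) mod M" using i by simp
qed

lemma supported_nth: "supported f r M \<Longrightarrow> n mod M \<noteq> r mod M \<Longrightarrow> f $ n = 0"
  by (auto simp: supported_def)

lemma supported_gf:
  assumes "\<And>x n. x \<in> S \<Longrightarrow> w x = int n \<Longrightarrow> n mod M = r mod M"
  shows "supported (gf w S) r M"
  unfolding supported_def
proof (intro allI impI)
  fix n assume "gf w S $ n \<noteq> 0"
  then have "{x \<in> S. w x = int n} \<noteq> {}" by (metis card.empty gf_nth of_nat_0)
  then show "n mod M = r mod M" using assms by blast
qed

lemma supported_add: "supported f r M \<Longrightarrow> supported g r M \<Longrightarrow> supported (f + g) r M"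
  by (auto simp: supported_def) (metis add_0)

lemma supported_two: "supported f r M \<Longrightarrow> supported (2 * f) r M"
  unfolding mult_2 by (rule supported_add)

section \<open>Theta series of the Eisenstein integers\<close>

text \<open>The pair \<open>(x, y)\<close> stands for \<open>x + y w\<close> with \<open>w\<^sup>2 + w + 1 = 0\<close>. Then \<open>rot\<close> is multiplication by \<open>w\<close>, and
since \<open>w \<equiv> 1\<close> modulo \<open>\<theta> = 1 + 2 w\<close>, the residue of \<open>x + y w\<close> modulo \<open>\<theta>\<close> is \<open>x + y\<close> modulo 3.\<close>
definition enorm :: "int \<times> int \<Rightarrow> int" where
  "enorm = (\<lambda>(x, y). x\<^sup>2 - x * y + y\<^sup>2)"

definition rot :: "int \<times> int \<Rightarrow> int \<times> int" where
  "rot = (\<lambda>(x, y). (- y, x - y))"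

definition residue :: "int \<Rightarrow> (int \<times> int) set" where
  "residue r = {(x, y). 3 dvd (x + y - r)}"

lemma enorm_rot [simp]: "enorm (rot z) = enorm z"
  by (cases z) (simp add: enorm_def rot_def power2_eq_square algebra_simps)

lemma enorm_bounds: "3 * x\<^sup>2 \<le> 4 * enorm (x, y)" "3 * y\<^sup>2 \<le> 4 * enorm (x, y)"
proof -
  have "4 * enorm (x, y) = (x - 2 * y)\<^sup>2 + 3 * x\<^sup>2"
    by (simp add: enorm_def power2_eq_square algebra_simps)
  then show "3 * x\<^sup>2 \<le> 4 * enorm (x, y)" by simp
  have "4 * enorm (x, y) = (2 * x - y)\<^sup>2 + 3 * y\<^sup>2"
    by (simp add: enorm_def power2_eq_square algebra_simps)
  then show "3 * y\<^sup>2 \<le> 4 * enorm (x, y)" by simp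
qed

lemma enorm_nonneg [simp]: "0 \<le> enorm z"
proof (cases z)
  case (Pair x y)
  have "0 \<le> 3 * x\<^sup>2" by simp
  also note enorm_bounds(1)[of x y]
  finally show ?thesis by (simp add: Pair)
qed

lemma enorm_ge_1: "enorm z \<noteq> 0 \<Longrightarrow> 1 \<le> enorm z"
  using enorm_nonneg[of z] by linarith

lemma abs_le_square: "\<bar>x\<bar> \<le> x\<^sup>2" for x :: int
  using self_le_power[of "\<bar>x\<bar>" 2] by (cases "x = 0") auto

lemma graded_enorm: "k > 0 \<Longrightarrow> graded (\<lambda>z. int k * enorm z) S"
proof (rule graded_subset[of _ UNIV])
  assume k: "k > 0"
  have "finite {z. int k * enorm z = n}" for n
  proof (rule finite_subset)
    show "{z. int k * enorm z = n} \<subseteq> {-2*n..2*n} \<times> {-2*n..2*n}"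
    proof (rule subsetI, clarsimp)
      fix x y
      have "1 * enorm (x, y) \<le> int k * enorm (x, y)"
        using k by (intro mult_right_mono) auto
      then show "- (2 * (int k * enorm (x, y))) \<le> x \<and> x \<le> 2 * (int k * enorm (x, y)) \<and>
          - (2 * (int k * enorm (x, y))) \<le> y \<and> y \<le> 2 * (int k * enorm (x, y))"
        using enorm_bounds(1)[of x y] enorm_bounds(2)[where x = x and y = y]
          abs_le_square[of x] abs_le_square[of y] by linarith
    qed
  qed auto
  then show "graded (\<lambda>z. int k * enorm z) UNIV" by (auto simp: graded_def)
qed auto

definition theta :: "int \<Rightarrow> nat \<Rightarrow> int fps" where
  "theta r k = gf (\<lambda>z. int k * enorm z) (residue r)"

definition parity :: "bool \<Rightarrow> bool \<Rightarrow> (int \<times> int) set" where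
  "parity i j = {(x, y). odd x = i \<and> odd y = j}"

text \<open>Of the four classes modulo 2, multiplication by \<open>w\<close> permutes the three nonzero ones and keeps residues
modulo \<open>\<theta>\<close>, so one of them stands for all three.\<close>
definition odd_theta :: "int \<Rightarrow> nat \<Rightarrow> int fps" where
  "odd_theta r k = gf (\<lambda>z. int k * enorm z) (residue r \<inter> parity True False)"

lemma bij_rot: "bij_betw rot (residue r \<inter> parity i j) (residue r \<inter> parity j (i \<noteq> j))"
proof (rule bij_betw_byWitness[where f' = "\<lambda>(x, y). (y - x, - x)"])
  have "3 dvd - y + (x - y) - r \<longleftrightarrow> 3 dvd x + y - r" "3 dvd (y - x) + - x - r \<longleftrightarrow> 3 dvd x + y - r" for x y :: int
    by presburger+
  then show "rot ` (residue r \<inter> parity i j) \<subseteq> residue r \<inter> parity j (i \<noteq> j)"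
      "(\<lambda>(x, y). (y - x, - x)) ` (residue r \<inter> parity j (i \<noteq> j)) \<subseteq> residue r \<inter> parity i j"
    by (auto simp: rot_def residue_def parity_def)
qed (auto simp: rot_def)

lemma gf_parity:
  shows "gf (\<lambda>z. int k * enorm z) (residue r \<inter> parity False True) = odd_theta r k"
    and "gf (\<lambda>z. int k * enorm z) (residue r \<inter> parity True True) = odd_theta r k"
proof -
  show 1: "gf (\<lambda>z. int k * enorm z) (residue r \<inter> parity False True) = odd_theta r k"
    unfolding odd_theta_def by (rule sym, rule gf_bij) (use bij_rot[of r True False] in auto)
  show "gf (\<lambda>z. int k * enorm z) (residue r \<inter> parity True True) = odd_theta r k"
    unfolding 1[symmetric] by (rule sym, rule gf_bij) (use bij_rot[of r False True] in auto)
qed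

text \<open>Dividing by \<open>-2\<close> instead of 2 keeps the residue modulo \<open>\<theta>\<close>, because \<open>-2 \<equiv> 1\<close> modulo 3.\<close>
lemma gf_parity_even:
  "gf (\<lambda>z. int k * enorm z) (residue r \<inter> parity False False) = theta r (4 * k)"
  unfolding theta_def
proof (rule sym, rule gf_bij)
  have "3 dvd - (2 * x) - 2 * y - r \<longleftrightarrow> 3 dvd x + y - r"
      "3 dvd 2 * x + 2 * y - r \<longleftrightarrow> 3 dvd - x - y - r" for x y :: int by presburger+
  then show "bij_betw (\<lambda>(x, y). (- 2 * x, - 2 * y)) (residue r) (residue r \<inter> parity False False)"
    by (intro bij_betw_byWitness[where f' = "\<lambda>(x, y). (- (x div 2), - (y div 2))"])
         (auto simp: residue_def parity_def elim!: evenE)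
qed (auto simp: enorm_def power2_eq_square algebra_simps)

lemma parity_disjoint: "z \<in> parity i j \<Longrightarrow> z \<in> parity i' j' \<Longrightarrow> i = i' \<and> j = j'"
  by (auto simp: parity_def)

lemma parity_cover:
  "S = (S \<inter> parity False False) \<union>
    ((S \<inter> parity True False) \<union> ((S \<inter> parity False True) \<union> (S \<inter> parity True True)))"
  by (auto simp: parity_def)

lemma theta_split:
  assumes "k > 0" shows "theta r k = theta r (4 * k) + 3 * odd_theta r k"
proof -
  have "theta r k = gf (\<lambda>z. int k * enorm z) ((residue r \<inter> parity False False) \<union> ((residue r \<inter> parity True False) \<union>
      ((residue r \<inter> parity False True) \<union> (residue r \<inter> parity True True))))"
    unfolding theta_def using parity_cover[of "residue r"] by simp
  also have "\<dots> = theta r (4 * k) + (odd_theta r k + (odd_theta r k + odd_theta r k))"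
    by (subst gf_Un, rule graded_enorm[OF assms], fastforce dest: parity_disjoint)+
       (simp add: gf_parity gf_parity_even flip: odd_theta_def)
  finally show ?thesis by simp
qed

lemma bij_sum_diff:
  "bij_betw (\<lambda>((x, y), (x', y')). ((x + x', y + y'), (x - x', y - y'))) (residue r \<times> residue s)
    {((a, b), (c, d)). (a, b) \<in> residue (r + s) \<and> (c, d) \<in> residue (r - s) \<and> even (a - c) \<and> even (b - d)}"
    (is "bij_betw ?f ?S ?T")
proof (rule bij_betw_imageI)
  show "inj_on ?f ?S" by (auto simp: inj_on_def)
  show "?f ` ?S = ?T"
  proof
    show "?f ` ?S \<subseteq> ?T"
    proof clarsimp
      fix x y x' y' assume "(x, y) \<in> residue r" "(x', y') \<in> residue s"
      then have "3 dvd (x + y - r) + (x' + y' - s)" "3 dvd (x + y - r) - (x' + y' - s)"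
        unfolding residue_def by (auto intro: dvd_add dvd_diff)
      then show "(x + x', y + y') \<in> residue (r + s) \<and> (x - x', y - y') \<in> residue (r - s)"
        by (simp add: residue_def algebra_simps)
    qed
    show "?T \<subseteq> ?f ` ?S"
    proof clarify
      fix a b c d assume *: "(a, b) \<in> residue (r + s)" "(c, d) \<in> residue (r - s)" "even (a - c)" "even (b - d)"
      then obtain x' y' where xy: "a - c = 2 * x'" "b - d = 2 * y'" by (meson dvdE)
      have h: "3 dvd a + b - (r + s)" "3 dvd c + d - (r - s)" using *(1,2) unfolding residue_def by auto
      have "3 dvd (a + b - (r + s)) - (c + d - (r - s))" by (rule dvd_diff[OF h])
      moreover have "(a + b - (r + s)) - (c + d - (r - s)) = 2 * (x' + y' - s)" using xy by simp
      ultimately have "3 dvd 2 * (x' + y' - s)" by metis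
      then have s: "3 dvd x' + y' - s" by presburger
      have "3 dvd (c + d - (r - s)) + (x' + y' - s)" by (rule dvd_add[OF h(2) s])
      moreover have "(c + d - (r - s)) + (x' + y' - s) = (c + x') + (d + y') - r" by simp
      ultimately have t: "3 dvd (c + x') + (d + y') - r" by metis
      then have "((c + x', d + y'), (x', y')) \<in> ?S"
        using s unfolding residue_def by blast
      moreover have "((a, b), (c, d)) = ?f ((c + x', d + y'), (x', y'))" using xy by simp
      ultimately show "((a, b), (c, d)) \<in> ?f ` ?S" by (rule rev_image_eqI)
    qed
  qed
qed

text \<open>The map of \<open>bij_sum_diff\<close> satisfies \<open>N(s + d) + N(s - d) = 2 N(s) + 2 N(d)\<close> and its image consists of
the pairs that agree modulo 2; the four parity classes give the four products on the right.\<close>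
lemma theta_duplication:
  assumes "k > 0"
  shows "theta r (2 * k) * theta s (2 * k)
    = theta (r + s) (4 * k) * theta (r - s) (4 * k) + 3 * (odd_theta (r + s) k * odd_theta (r - s) k)"
proof -
  let ?w = "\<lambda>(u, v). int k * enorm u + int k * enorm v"
  define P where "P i j = (residue (r + s) \<inter> parity i j) \<times> (residue (r - s) \<inter> parity i j)" for i j
  have P: "gf ?w (P i j) = gf (\<lambda>z. int k * enorm z) (residue (r + s) \<inter> parity i j)
      * gf (\<lambda>z. int k * enorm z) (residue (r - s) \<inter> parity i j)" for i j
    unfolding P_def by (intro gf_mult[symmetric] graded_enorm assms)
  have G: "graded ?w S" for S
    by (rule graded_subset[OF graded_Times[OF graded_enorm[OF assms] graded_enorm[OF assms]],
          of _ UNIV UNIV]) auto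
  have "theta r (2 * k) * theta s (2 * k)
      = gf (\<lambda>(u, v). int (2 * k) * enorm u + int (2 * k) * enorm v) (residue r \<times> residue s)"
    unfolding theta_def using assms by (intro gf_mult graded_enorm) auto
  also have "\<dots> = gf ?w (P False False \<union> (P True False \<union> (P False True \<union> P True True)))"
  proof (rule gf_bij)
    have "P False False \<union> (P True False \<union> (P False True \<union> P True True)) = {((a, b), (c, d)).
        (a, b) \<in> residue (r + s) \<and> (c, d) \<in> residue (r - s) \<and> even (a - c) \<and> even (b - d)}"
      unfolding P_def parity_def by auto
    then show "bij_betw (\<lambda>((x, y), (x', y')). ((x + x', y + y'), (x - x', y - y')))
        (residue r \<times> residue s) (P False False \<union> (P True False \<union> (P False True \<union> P True True)))"
      using bij_sum_diff[of r s] by simp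
  qed (auto simp: enorm_def power2_eq_square algebra_simps)
  also have "\<dots> = gf ?w (P False False) + (gf ?w (P True False) + (gf ?w (P False True) + gf ?w (P True True)))"
    unfolding P_def by (subst gf_Un, rule G, fastforce dest: parity_disjoint)+ simp
  finally show ?thesis
    unfolding P gf_parity gf_parity_even odd_theta_def[symmetric] by simp
qed

lemma theta_residue_cong: "3 dvd (r - s) \<Longrightarrow> theta r k = theta s k"
proof -
  assume "3 dvd (r - s)"
  then have "residue r = residue s" unfolding residue_def by auto presburger+
  then show ?thesis by (simp add: theta_def)
qed

lemma theta_uminus: "theta (- r) k = theta r k"
  unfolding theta_def
proof (rule gf_bij)
  have "3 dvd - x - y - r \<longleftrightarrow> 3 dvd x + y + r" "3 dvd - x - y + r \<longleftrightarrow> 3 dvd x + y - r" for x y :: int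
    by presburger+
  then show "bij_betw (\<lambda>(x, y). (- x, - y)) (residue (- r)) (residue r)"
    by (intro bij_betw_byWitness[where f' = "\<lambda>(x, y). (- x, - y)"]) (auto simp: residue_def)
qed (auto simp: enorm_def)

lemma theta_2 [simp]: "theta 2 k = theta 1 k"
  using theta_residue_cong[of 2 "-1" k] theta_uminus[of 1 k] by simp

lemma odd_theta_2 [simp]: "k > 0 \<Longrightarrow> odd_theta 2 k = odd_theta 1 k"
  using theta_split[of k 2] theta_split[of k 1] by simp

text \<open>In terms of \<open>q = X\<^sup>3\<close> these are the Borwein theta functions \<open>a(q\<^sup>k)\<close> and \<open>c(q\<^sup>k)\<close>. The first is usually
defined by summing \<open>q\<^bsup>N(z)\<^esup>\<close> over all of \<open>\<int>[w]\<close>; here \<open>z\<close> is replaced by \<open>\<theta> z\<close>, whose norm is \<open>3 N(z)\<close>.\<close>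
abbreviation "borwein_a \<equiv> theta 0"
abbreviation "borwein_c \<equiv> theta 1"

lemma duplication_aa:
  "k > 0 \<Longrightarrow> borwein_a (2*k) * borwein_a (2*k)
    = borwein_a (4*k) * borwein_a (4*k) + 3 * (odd_theta 0 k * odd_theta 0 k)"
  using theta_duplication[of k 0 0] by simp

lemma duplication_ca:
  "k > 0 \<Longrightarrow> borwein_c (2*k) * borwein_a (2*k)
    = borwein_c (4*k) * borwein_c (4*k) + 3 * (odd_theta 1 k * odd_theta 1 k)"
  using theta_duplication[of k 1 0] by simp

lemma duplication_cc:
  "k > 0 \<Longrightarrow> borwein_c (2*k) * borwein_c (2*k)
    = borwein_c (4*k) * borwein_a (4*k) + 3 * (odd_theta 1 k * odd_theta 0 k)"
  using theta_duplication[of k 1 1] by simp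

section \<open>Two identities of degree two, by descent\<close>

text \<open>The errors of the identities \<open>c(q)\<^sup>2 = c(q\<^sup>2) (a(q) + 2 a(q\<^sup>2))\<close> and \<open>c(q) (a(q) - a(q\<^sup>2)) = 2 c(q\<^sup>2)\<^sup>2\<close>,
with \<open>q\<^sup>k\<close> in place of \<open>q\<close>.\<close>
definition defect1 where
  "defect1 k = borwein_c k ^ 2 - borwein_c (2*k) * (borwein_a k + 2 * borwein_a (2*k))"

definition defect2 where
  "defect2 k = borwein_c k * (borwein_a k - borwein_a (2*k)) - 2 * borwein_c (2*k) ^ 2"

text \<open>Both relations lie in the ideal generated by the duplication formulas for \<open>c\<^sub>2 a\<^sub>2\<close> and \<open>c\<^sub>2\<^sup>2\<close>, after
\<open>a\<^sub>1\<close> and \<open>c\<^sub>1\<close> are split modulo 2.\<close>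
lemma descent:
  assumes "k > 0"
  shows "(borwein_c k - borwein_c (4*k)) * defect1 k = (borwein_c k + 2 * borwein_c (4*k)) * defect2 (2*k) - 3 * borwein_c (2*k) * defect1 (2*k)"
    and "(borwein_c k - borwein_c (4*k)) * defect2 k = (borwein_c k + 2 * borwein_c (4*k)) * defect1 (2*k) - 3 * borwein_a (2*k) * defect2 (2*k)"
proof -
  have split: "borwein_a k = borwein_a (4*k) + 3 * odd_theta 0 k" "borwein_c k = borwein_c (4*k) + 3 * odd_theta 1 k" "2 * (2 * k) = 4 * k"
    using theta_split[OF assms] by auto
  \<comment> \<open>The right-hand side exhibits the ideal membership: the two duplication formulas with explicit cofactors.\<close>
  have "(c + 3*g - c) * ((c + 3*g)\<^sup>2 - c2 * (a + 3*b + 2*a2))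
        - ((c + 3*g + 2*c) * (c2 * (a2 - a) - 2*c\<^sup>2) - 3*c2 * (c2\<^sup>2 - c * (a2 + 2*a)))
      = 3*c2 * (c2*c2 - (c*a + 3*(g*b))) - 3*(3*g + 2*c) * (c2*a2 - (c*c + 3*(g*g)))"
    for a b c g a2 c2 :: "'r :: comm_ring_1"
    by (simp add: power2_eq_square algebra_simps)
  from this[of "borwein_c (4*k)" "odd_theta 1 k" "borwein_c (2*k)" "borwein_a (4*k)" "odd_theta 0 k" "borwein_a (2*k)"]
  show "(borwein_c k - borwein_c (4*k)) * defect1 k = (borwein_c k + 2 * borwein_c (4*k)) * defect2 (2*k) - 3 * borwein_c (2*k) * defect1 (2*k)"
    unfolding defect1_def defect2_def split duplication_ca[OF assms] duplication_cc[OF assms] by simp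
  have "(c + 3*g - c) * ((c + 3*g) * (a + 3*b - a2) - 2*c2\<^sup>2)
        - ((c + 3*g + 2*c) * (c2\<^sup>2 - c * (a2 + 2*a)) - 3*a2 * (c2 * (a2 - a) - 2*c\<^sup>2))
      = 3*(a2 - a) * (c2*a2 - (c*c + 3*(g*g))) - 3*(3*g + c) * (c2*c2 - (c*a + 3*(g*b)))"
    for a b c g a2 c2 :: "'r :: comm_ring_1"
    by (simp add: power2_eq_square algebra_simps)
  from this[of "borwein_c (4*k)" "odd_theta 1 k" "borwein_a (4*k)" "odd_theta 0 k" "borwein_a (2*k)" "borwein_c (2*k)"]
  show "(borwein_c k - borwein_c (4*k)) * defect2 k = (borwein_c k + 2 * borwein_c (4*k)) * defect1 (2*k) - 3 * borwein_a (2*k) * defect2 (2*k)"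
    unfolding defect1_def defect2_def split duplication_ca[OF assms] duplication_cc[OF assms] by simp
qed

lemma fps_X_power_dvd_iff: "fps_X ^ m dvd (f :: int fps) \<longleftrightarrow> f = 0 \<or> m \<le> subdegree f"
proof
  assume "fps_X ^ m dvd f"
  then obtain g where "f = fps_X ^ m * g" by (elim dvdE)
  then show "f = 0 \<or> m \<le> subdegree f" by (cases "g = 0") auto
next
  assume "f = 0 \<or> m \<le> subdegree f"
  then have "f = fps_X ^ m * fps_shift m f"
    by (intro fps_ext) (auto simp: fps_X_power_mult_nth nth_less_subdegree_zero)
  then show "fps_X ^ m dvd f" by (rule dvdI)
qed

text \<open>The smallest norm in the coset \<open>1 + \<theta> \<int>[w]\<close> is 1, so \<open>c(q\<^sup>k)\<close> starts exactly at \<open>X\<^sup>k\<close>. The descent divides by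
\<open>c(q\<^sup>k) - c(q\<^bsup>4k\<^esup>)\<close> and needs this order precisely.\<close>
lemma theta_1_nth_low:
  assumes "n < k" shows "borwein_c k $ n = 0"
proof -
  have "int k * enorm z \<noteq> int n" if z: "z \<in> residue 1" for z
  proof
    assume *: "int k * enorm z = int n"
    have "enorm z = 0"
    proof (rule ccontr)
      assume "enorm z \<noteq> 0"
      then have "int k * 1 \<le> int k * enorm z"
        by (intro mult_left_mono enorm_ge_1) auto
      then show False using * assms by simp
    qed
    moreover obtain x y where "z = (x, y)" by force
    ultimately have "z = (0, 0)"
      using enorm_bounds(1)[of x y] enorm_bounds(2)[where x = x and y = y] by simp
    then show False using z by (simp add: residue_def)
  qed
  then have "{z \<in> residue 1. int k * enorm z = int n} = {}" by blast
  then show ?thesis by (simp only: theta_def gf_nth card.empty)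
qed

lemma theta_1_nth_self:
  assumes "k > 0" shows "borwein_c k $ k \<noteq> 0"
proof -
  have "finite {z \<in> residue 1. int k * enorm z = int k}"
    using graded_enorm[OF assms, of "residue 1"] unfolding graded_def by blast
  moreover have "(1, 0) \<in> {z \<in> residue 1. int k * enorm z = int k}"
    by (auto simp: residue_def enorm_def)
  ultimately show ?thesis by (auto simp: theta_def gf_nth card_eq_0_iff)
qed

lemma subdegree_theta_1: "k > 0 \<Longrightarrow> subdegree (borwein_c k) = k"
  by (auto intro!: subdegreeI simp: theta_1_nth_low theta_1_nth_self)

lemma subdegree_theta_1_diff: "k > 0 \<Longrightarrow> subdegree (borwein_c k - borwein_c (4 * k)) = k"
  by (auto intro!: subdegreeI simp: theta_1_nth_low theta_1_nth_self)

lemma X_dvd_theta_1: "k > 0 \<Longrightarrow> m \<le> k \<Longrightarrow> fps_X ^ m dvd borwein_c k"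
  by (simp add: fps_X_power_dvd_iff subdegree_theta_1)

lemma X_dvd_theta_0_diff:
  assumes "k > 0" shows "fps_X ^ k dvd borwein_a k - borwein_a (2 * k)"
proof -
  have "(borwein_a k - borwein_a (2 * k)) $ n = 0" if "n < k" for n
  proof (cases "n = 0")
    case True
    then show ?thesis using assms by (simp add: theta_def gf_nth)
  next
    case False
    have "int j * enorm z \<noteq> int n" if j: "j \<ge> k" for j z
    proof
      assume *: "int j * enorm z = int n"
      then have "enorm z \<noteq> 0" using False by auto
      then have "int j * 1 \<le> int j * enorm z"
        by (intro mult_left_mono enorm_ge_1) auto
      then show False using * \<open>n < k\<close> j by simp
    qed
    from this[of k] this[of "2 * k"]
    have "{z \<in> residue 0. int k * enorm z = int n} = {}" "{z \<in> residue 0. int (2 * k) * enorm z = int n} = {}"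
      by auto
    then show ?thesis by (simp only: theta_def gf_nth card.empty fps_sub_nth)
  qed
  then show ?thesis by (auto simp: fps_X_power_dvd_iff intro!: subdegree_geI)
qed

text \<open>The claim is made for all \<open>k\<close> at once, because the induction step for \<open>k\<close> uses the hypothesis for \<open>2 k\<close>,
where it gives twice the order. After division by a series of order \<open>k\<close> there remains the order
\<open>k (2 d - 1)\<close>, which is at least \<open>k (d + 1)\<close> exactly when \<open>d \<ge> 2\<close>; this is why the induction starts at 2.\<close>
lemma defects_low:
  assumes "k > 0" "d \<ge> 2"
  shows "fps_X ^ (k * d) dvd defect1 k \<and> fps_X ^ (k * d) dvd defect2 k"
  using assms(2,1)
proof (induction d arbitrary: k rule: dec_induct)
  case base
  have X: "fps_X ^ (k * 2) = fps_X ^ k * (fps_X ^ k :: int fps)" by (simp add: mult_2_right power_add)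
  have 1: "fps_X ^ (k * 2) dvd borwein_c k * borwein_c k" "fps_X ^ (k * 2) dvd borwein_c k * (borwein_a k - borwein_a (2 * k))"
    unfolding X using base by (intro mult_dvd_mono X_dvd_theta_1 X_dvd_theta_0_diff; simp)+
  have 2: "fps_X ^ (k * 2) dvd borwein_c (2 * k)" using base by (intro X_dvd_theta_1) auto
  show ?case
    unfolding defect1_def defect2_def power2_eq_square using 1 dvd_mult2[OF 2] dvd_mult[OF 2] by (intro conjI dvd_diff) simp_all
next
  case (step d)
  have k2: "2 * k > 0" using step by simp
  have IH: "fps_X ^ (2 * k * d) dvd defect1 (2 * k)" "fps_X ^ (2 * k * d) dvd defect2 (2 * k)"
    using step.IH[OF k2] by auto
  have le: "k + k * Suc d \<le> 2 * k * d"
  proof -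
    have "k * (2 + d) \<le> k * (2 * d)" using step by (intro mult_left_mono) auto
    then show ?thesis by (simp add: algebra_simps)
  qed
  have cancel: "fps_X ^ (k * Suc d) dvd f" if "fps_X ^ (k + k * Suc d) dvd (borwein_c k - borwein_c (4 * k)) * f" for f
  proof (cases "f = 0")
    case False
    moreover have "borwein_c k - borwein_c (4 * k) \<noteq> 0"
      using subdegree_theta_1_diff[OF step.prems] step.prems by auto
    ultimately show ?thesis
      using that subdegree_theta_1_diff[OF step.prems] by (simp add: fps_X_power_dvd_iff)
  qed auto
  have "fps_X ^ (2 * k * d) dvd (borwein_c k - borwein_c (4 * k)) * defect1 k"
    unfolding descent(1)[OF step.prems] by (rule dvd_diff; rule dvd_mult; rule IH)
  moreover have "fps_X ^ (2 * k * d) dvd (borwein_c k - borwein_c (4 * k)) * defect2 k"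
    unfolding descent(2)[OF step.prems] by (rule dvd_diff; rule dvd_mult; rule IH)
  ultimately show ?case using cancel le_imp_power_dvd[OF le] dvd_trans by blast
qed

lemma defects_zero: assumes "k > 0" shows "defect1 k = 0" "defect2 k = 0"
proof -
  have "f = 0" if "\<And>d. d \<ge> 2 \<Longrightarrow> fps_X ^ (k * d) dvd f" for f :: "int fps"
  proof (rule ccontr)
    assume "f \<noteq> 0"
    then have "k * (subdegree f + 2) \<le> subdegree f"
      using that[of "subdegree f + 2"] by (auto simp: fps_X_power_dvd_iff)
    moreover have "1 * (subdegree f + 2) \<le> k * (subdegree f + 2)"
      using assms by (intro mult_right_mono) auto
    ultimately show False by simp
  qed
  then show "defect1 k = 0" "defect2 k = 0" using defects_low[OF assms] by blast+
qed

text \<open>The difference of the two sides is \<open>2 c\<^sub>2\<close> times the first error minus \<open>a\<^sub>1\<close> times the second.\<close>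
lemma borwein_product_identity:
  "borwein_a 1 * borwein_a 2 * borwein_c 1 + 2 * borwein_c 1 ^ 2 * borwein_c 2
    = borwein_a 1 ^ 2 * borwein_c 1 + 4 * borwein_a 2 * borwein_c 2 ^ 2"
proof -
  have "borwein_a 1 * borwein_a 2 * borwein_c 1 + 2 * borwein_c 1 ^ 2 * borwein_c 2 = borwein_a 1 ^ 2 * borwein_c 1 + 4 * borwein_a 2 * borwein_c 2 ^ 2
      + (2 * borwein_c 2 * defect1 1 - borwein_a 1 * defect2 1)"
    unfolding defect1_def defect2_def mult_1_right by (simp add: power2_eq_square algebra_simps)
  then show ?thesis by (simp add: defects_zero)
qed

section \<open>Reduction of the senary form to the norm\<close>

lemma residue_iff_mod: "(x, y) \<in> residue r \<longleftrightarrow> (x + y) mod 3 = r mod 3"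
  by (simp add: residue_def mod_eq_dvd_iff)

lemma enorm_mod_3: "enorm (x, y) mod 3 = ((x + y) mod 3)\<^sup>2 mod 3"
proof -
  have "enorm (x, y) - (x + y)\<^sup>2 = 3 * (- (x * y))"
    by (simp add: enorm_def power2_eq_square algebra_simps)
  then have "enorm (x, y) mod 3 = (x + y)\<^sup>2 mod 3"
    unfolding mod_eq_dvd_iff by (metis dvd_triv_left)
  then show ?thesis by (simp add: power_mod)
qed

lemma supported_theta_0: "supported (borwein_a k) 0 3"
  unfolding theta_def
proof (rule supported_gf)
  fix z n assume z: "z \<in> residue 0" "int k * enorm z = int n"
  obtain x y where xy: "z = (x, y)" by force
  then have "enorm z mod 3 = 0" using z enorm_mod_3[of x y] by (simp add: residue_iff_mod)
  then have "int n mod 3 = 0" unfolding z(2)[symmetric] by (metis mod_mult_right_eq mult_zero_right mod_0)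
  then show "n mod 3 = 0 mod 3" by presburger
qed

lemma supported_theta_1: "supported (borwein_c k) k 3"
  unfolding theta_def
proof (rule supported_gf)
  fix z n assume z: "z \<in> residue 1" "int k * enorm z = int n"
  obtain x y where xy: "z = (x, y)" by force
  then have "enorm z mod 3 = 1" using z enorm_mod_3[of x y] by (simp add: residue_iff_mod)
  then have "int n mod 3 = int k mod 3" unfolding z(2)[symmetric] by (metis mod_mult_right_eq mult_1_right)
  then show "n mod 3 = k mod 3" by (metis of_nat_eq_iff of_nat_mod of_nat_numeral)
qed

lemma supported_theta_dvd:
  assumes "M dvd k" shows "supported (theta r k) 0 M"
  unfolding theta_def
proof (rule supported_gf)
  fix z n assume z: "z \<in> residue r" "int k * enorm z = int n"
  have "int M dvd int n" unfolding z(2)[symmetric] using assms by (intro dvd_mult2) auto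
  then show "n mod M = 0 mod M" by simp
qed

lemma supported_odd_theta: "supported (odd_theta r 1) 1 2"
  unfolding odd_theta_def
proof (rule supported_gf)
  fix z n assume z: "z \<in> residue r \<inter> parity True False" "int 1 * enorm z = int n"
  obtain x y where xy: "z = (x, y)" by force
  have "odd (int n)" unfolding z(2)[symmetric] using z(1) by (auto simp: xy parity_def enorm_def)
  then show "n mod 2 = 1 mod 2" by presburger
qed

definition theta_full :: "nat \<Rightarrow> int fps" where
  "theta_full k = gf (\<lambda>z. int k * enorm z) UNIV"

lemma theta_full_eq: assumes "k > 0" shows "theta_full k = borwein_a k + 2 * borwein_c k"
proof -
  have "UNIV = residue 0 \<union> (residue 1 \<union> residue 2)" by (auto simp: residue_iff_mod)
  then have "theta_full k = gf (\<lambda>z. int k * enorm z) (residue 0 \<union> (residue 1 \<union> residue 2))" by (simp add: theta_full_def)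
  also have "\<dots> = borwein_a k + (borwein_c k + theta 2 k)" unfolding theta_def
    by (subst gf_Un, rule graded_enorm[OF assms], force simp: residue_iff_mod)+ simp
  finally show ?thesis by simp
qed

text \<open>The subring \<open>\<int>[\<theta>]\<close>: the element \<open>x + y \<theta>\<close> is \<open>(x + y) + 2 y w\<close> and has norm \<open>x\<^sup>2 + 3 y\<^sup>2\<close>.\<close>
definition zsqrt_minus_3 :: "(int \<times> int) set" where "zsqrt_minus_3 = {(x, y). even y}"

lemma gf_zsqrt_minus_3:
  "gf enorm zsqrt_minus_3 = theta_full 4 + (odd_theta 0 1 + 2 * odd_theta 1 1)"
proof -
  have "zsqrt_minus_3 = (residue 0 \<inter> parity False False \<union> (residue 1 \<inter> parity False False \<union> residue 2 \<inter> parity False False)) \<union>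
     (residue 0 \<inter> parity True False \<union> (residue 1 \<inter> parity True False \<union> residue 2 \<inter> parity True False))" (is "_ = ?S")
    by (auto simp: zsqrt_minus_3_def residue_iff_mod parity_def)
  then have "gf enorm zsqrt_minus_3 = gf (\<lambda>z. int 1 * enorm z) ?S" by simp
  also have "\<dots> = (borwein_a 4 + (borwein_c 4 + theta 2 4)) + (odd_theta 0 1 + (odd_theta 1 1 + odd_theta 2 1))"
    unfolding odd_theta_def
    by (subst gf_Un, rule graded_enorm, simp, force simp: residue_iff_mod parity_def)+
       (use gf_parity_even[of 1] in simp)
  finally show ?thesis by (simp add: theta_full_eq)
qed

text \<open>The duplication formulas for all pairs of residues, added up. Together with \<open>gf_zsqrt_minus_3\<close> this
expresses the square of the odd part of the theta series of \<open>\<int>[\<theta>]\<close> by full theta series.\<close>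
lemma theta_full_square:
  "3 * (odd_theta 0 1 + 2 * odd_theta 1 1)\<^sup>2 = theta_full 2 ^ 2 - theta_full 4 ^ 2"
  using duplication_aa[of 1] duplication_ca[of 1] duplication_cc[of 1] by (simp add: theta_full_eq) algebra

lemma omega_eq:
  "int (omega n)
    = (gf enorm zsqrt_minus_3 * (gf enorm zsqrt_minus_3 * gf enorm zsqrt_minus_3)) $ n"
proof -
  let ?T = "zsqrt_minus_3 \<times> zsqrt_minus_3 \<times> zsqrt_minus_3"
  let ?f = "\<lambda>(x1, x2, x3, y1, y2, y3). ((x1 + y1, 2 * y1), (x2 + y2, 2 * y2), (x3 + y3, 2 * y3))"
  have g: "graded enorm zsqrt_minus_3" using graded_enorm[of 1] by simp
  have N: "enorm (x + y, 2 * y) = x\<^sup>2 + 3 * y\<^sup>2" for x y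
    by (simp add: enorm_def power2_eq_square algebra_simps)
  have "bij_betw ?f {(x1::int, x2::int, x3::int, y1::int, y2::int, y3::int).
       x1^2 + x2^2 + x3^2 + 3 * y1^2 + 3 * y2^2 + 3 * y3^2 = int n}
     {t \<in> ?T. (case t of (x, y, z) \<Rightarrow> enorm x + (enorm y + enorm z)) = int n}" (is "bij_betw _ ?X ?Y")
  proof (rule bij_betw_imageI)
    show "inj_on ?f ?X" by (auto simp: inj_on_def)
    show "?f ` ?X = ?Y"
    proof
      show "?f ` ?X \<subseteq> ?Y" by (auto simp: N zsqrt_minus_3_def)
      show "?Y \<subseteq> ?f ` ?X"
      proof (rule subsetI)
        fix t assume t: "t \<in> ?Y"
        then obtain x1 y1 x2 y2 x3 y3 where e: "t = ((x1, 2 * y1), (x2, 2 * y2), (x3, 2 * y3))"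
          by (auto simp: zsqrt_minus_3_def elim!: evenE)
        then have "t = ?f (x1 - y1, x2 - y2, x3 - y3, y1, y2, y3)" by simp
        moreover have "(x1 - y1, x2 - y2, x3 - y3, y1, y2, y3) \<in> ?X"
          using t N[of "x1 - y1" y1] N[of "x2 - y2" y2] N[of "x3 - y3" y3] by (simp add: e)
        ultimately show "t \<in> ?f ` ?X" by blast
      qed
    qed
  qed
  then have "omega n = card ?Y" unfolding omega_def by (rule bij_betw_same_card)
  then show ?thesis by (simp add: gf3[OF g g g] gf_nth)
qed

lemma theta_full_scale:
  "(theta_full 4 * (theta_full 2 * theta_full 2)) $ (2 * m)
    = (theta_full 2 * (theta_full 1 * theta_full 1)) $ m"
proof -
  have g: "graded (\<lambda>z. int k * enorm z) UNIV" if "k > 0" for k using that by (rule graded_enorm)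
  have "4 * a + (2 * b + 2 * c) = 2 * int m \<longleftrightarrow> 2 * a + (b + c) = int m" for a b c :: int by auto
  moreover have "theta_full i * (theta_full j * theta_full j) = gf (\<lambda>(x, y, z). int i * enorm x + (int j * enorm y + int j * enorm z))
      (UNIV \<times> UNIV \<times> UNIV)" if "i > 0" "j > 0" for i j
    unfolding theta_full_def by (intro gf3 g that)
  ultimately show ?thesis by (simp add: gf_nth split_def)
qed

text \<open>Cube the theta series of \<open>\<int>[\<theta>]\<close>, written as even part plus odd part \<open>U\<close>. Terms with an odd number of
factors \<open>U\<close> have odd exponents only, and \<open>3 U\<^sup>2\<close> is known; its subtracted part cancels the cube of the
even part.\<close>
lemma omega_even:
  assumes "odd m" shows "int (omega (2 * m)) = (theta_full 2 * (theta_full 1 * theta_full 1)) $ m"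
proof -
  define U where "U = odd_theta 0 1 + 2 * odd_theta 1 1"
  have U: "supported U 1 2" unfolding U_def
    by (intro supported_add supported_two supported_odd_theta)
  have F: "supported (theta_full 4) 0 2"
    unfolding theta_full_eq[of 4, simplified] by (intro supported_add supported_two supported_theta_dvd) auto
  have "gf enorm zsqrt_minus_3 * (gf enorm zsqrt_minus_3 * gf enorm zsqrt_minus_3)
      = theta_full 4 * (theta_full 4 * theta_full 4) + 3 * (theta_full 4 * theta_full 4 * U) + theta_full 4 * (3 * U\<^sup>2) + U * (U * U)"
    unfolding gf_zsqrt_minus_3 U_def[symmetric] by (simp add: power2_eq_square algebra_simps)
  also have "\<dots> = 3 * (theta_full 4 * theta_full 4 * U) + theta_full 4 * (theta_full 2 * theta_full 2) + U * (U * U)"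
    unfolding U_def theta_full_square by (simp add: power2_eq_square algebra_simps)
  finally have "int (omega (2 * m)) = (3 * (theta_full 4 * theta_full 4 * U)) $ (2 * m)
      + (theta_full 4 * (theta_full 2 * theta_full 2)) $ (2 * m) + (U * (U * U)) $ (2 * m)"
    by (simp add: omega_eq)
  moreover have "(theta_full 4 * theta_full 4 * U) $ (2 * m) = 0"
    by (rule supported_nth[OF supported_mult[OF supported_mult[OF F F] U]]) simp
  moreover have "(U * (U * U)) $ (2 * m) = 0"
    by (rule supported_nth[OF supported_mult[OF U supported_mult[OF U U]]]) simp
  ultimately show ?thesis by (simp add: theta_full_scale numeral_fps_const fps_mult_left_const_nth)
qed

text \<open>Split each full theta series by residues modulo \<open>\<theta>\<close>. Norms are squares modulo \<open>\<theta>\<close>, so only products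
whose exponents are 1 modulo 3 contribute, and \<open>borwein_product_identity\<close> rewrites their sum.\<close>
lemma omega_eq_caa:
  assumes "odd m" "m mod 3 = 1"
  shows "int (omega (2 * m)) = 4 * (borwein_c 1 * (borwein_a 1 * borwein_a 1)) $ m"
proof -
  have s: "supported (borwein_a 1) 0 3" "supported (borwein_a 2) 0 3" "supported (borwein_c 1) 1 3" "supported (borwein_c 2) 2 3"
    by (rule supported_theta_0 supported_theta_1)+
  have "theta_full 2 * (theta_full 1 * theta_full 1)
      = borwein_a 2 * (borwein_a 1 * borwein_a 1) + 8 * (borwein_a 1 * (borwein_c 1 * borwein_c 2)) + 2 * (borwein_a 1 * (borwein_a 1 * borwein_c 2)) + 4 * (borwein_a 2 * (borwein_c 1 * borwein_c 1))
        + 4 * (borwein_a 1 * borwein_a 2 * borwein_c 1 + 2 * borwein_c 1 ^ 2 * borwein_c 2)"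
    by (simp add: theta_full_eq power2_eq_square algebra_simps)
  also have "4 * (borwein_a 1 * borwein_a 2 * borwein_c 1 + 2 * borwein_c 1 ^ 2 * borwein_c 2) = 4 * (borwein_c 1 * (borwein_a 1 * borwein_a 1)) + 16 * (borwein_a 2 * (borwein_c 2 * borwein_c 2))"
    unfolding borwein_product_identity by (simp add: power2_eq_square algebra_simps)
  finally have "(theta_full 2 * (theta_full 1 * theta_full 1)) $ m = (borwein_a 2 * (borwein_a 1 * borwein_a 1)) $ m + 8 * (borwein_a 1 * (borwein_c 1 * borwein_c 2)) $ m
      + 2 * (borwein_a 1 * (borwein_a 1 * borwein_c 2)) $ m + 4 * (borwein_a 2 * (borwein_c 1 * borwein_c 1)) $ m
      + (4 * (borwein_c 1 * (borwein_a 1 * borwein_a 1)) $ m + 16 * (borwein_a 2 * (borwein_c 2 * borwein_c 2)) $ m)"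
    by (simp add: numeral_fps_const fps_mult_left_const_nth)
  moreover have "(borwein_a 2 * (borwein_a 1 * borwein_a 1)) $ m = 0"
    by (rule supported_nth[OF supported_mult[OF s(2) supported_mult[OF s(1) s(1)]]]) (use assms in simp)
  moreover have "(borwein_a 1 * (borwein_c 1 * borwein_c 2)) $ m = 0"
    by (rule supported_nth[OF supported_mult[OF s(1) supported_mult[OF s(3) s(4)]]]) (use assms in simp)
  moreover have "(borwein_a 1 * (borwein_a 1 * borwein_c 2)) $ m = 0"
    by (rule supported_nth[OF supported_mult[OF s(1) supported_mult[OF s(1) s(4)]]]) (use assms in simp)
  moreover have "(borwein_a 2 * (borwein_c 1 * borwein_c 1)) $ m = 0"
    by (rule supported_nth[OF supported_mult[OF s(2) supported_mult[OF s(3) s(3)]]]) (use assms in simp)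
  moreover have "(borwein_a 2 * (borwein_c 2 * borwein_c 2)) $ m = 0"
  proof -
    have e: "supported (theta r 2) 0 2" for r by (rule supported_theta_dvd) simp
    show ?thesis by (rule supported_nth[OF supported_mult[OF e supported_mult[OF e e]]])
      (use assms in presburger)
  qed
  ultimately show ?thesis using omega_even[OF assms(1)] by simp
qed

section \<open>The discrete Fourier transform of order three\<close>

definition triple_norm :: "(int \<times> int) \<times> (int \<times> int) \<times> (int \<times> int) \<Rightarrow> int" where
  "triple_norm = (\<lambda>(x, y, z). enorm x + (enorm y + enorm z))"

lemma graded_enorm_1: "graded enorm S" using graded_enorm[of 1 S] by simp

lemma gf_triple: "gf enorm R * (gf enorm S * gf enorm T) = gf triple_norm (R \<times> S \<times> T)"
  unfolding triple_norm_def by (intro gf3 graded_enorm_1)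

lemma graded_triple_norm: "graded triple_norm S"
proof -
  have "(\<lambda>(x, yz). enorm x + (case yz of (y, z) \<Rightarrow> enorm y + enorm z)) = triple_norm"
    by (auto simp: triple_norm_def)
  then have "graded triple_norm (UNIV \<times> UNIV \<times> UNIV)"
    using graded_Times[OF graded_enorm_1 graded_Times[OF graded_enorm_1 graded_enorm_1]] by metis
  then show ?thesis by (rule graded_subset) auto
qed

text \<open>For \<open>u\<^sub>1, u\<^sub>2, u\<^sub>3 \<equiv> 1\<close> modulo \<open>\<theta>\<close>, the sum \<open>u\<^sub>1 + w u\<^sub>2 + w\<^sup>2 u\<^sub>3\<close> is divisible by 3 if and only if the
first coordinates add up to 0 modulo 3. So \<open>slice 0\<close> is the domain on which all three components of
the Fourier transform are divisible by 3.\<close>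
definition slice :: "int \<Rightarrow> ((int \<times> int) \<times> (int \<times> int) \<times> (int \<times> int)) set" where
  "slice j = {((x1, y1), (x2, y2), (x3, y3)).
    3 dvd x1 + y1 - 1 \<and> 3 dvd x2 + y2 - 1 \<and> 3 dvd x3 + y3 - 1 \<and> 3 dvd x1 + x2 + x3 - j}"

text \<open>Multiplication of \<open>u\<^sub>1\<close> by \<open>w\<close> replaces \<open>x\<^sub>1\<close> by \<open>- y\<^sub>1\<close>, which is \<open>x\<^sub>1 - 1\<close> modulo 3.\<close>
lemma gf_slice_shift: "gf triple_norm (slice j) = gf triple_norm (slice (j - 1))"
proof (rule gf_bij)
  let ?f = "\<lambda>((x, y), u2, u3). ((- y, x - y), u2, u3)"
  let ?g = "\<lambda>((x, y), u2, u3). ((y - x, - x), u2, u3)"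
  have 1: "3 dvd (- y + (x - y)) - 1 \<longleftrightarrow> 3 dvd x + y - 1" "3 dvd (y - x + - x) - 1 \<longleftrightarrow> 3 dvd x + y - 1" for x y :: int
    by presburger+
  have 2: "3 dvd - y + x2 + x3 - (j - 1)" if "3 dvd x + y - 1" "3 dvd x + x2 + x3 - j" for x y x2 x3
  proof -
    have "- y + x2 + x3 - (j - 1) = (x + x2 + x3 - j) - (x + y - 1)" by simp
    then show ?thesis using dvd_diff[OF that(2,1)] by metis
  qed
  have 3: "3 dvd y - x + x2 + x3 - j" if "3 dvd x + y - 1" "3 dvd x + x2 + x3 - (j - 1)" for x y x2 x3
  proof -
    have "y - x + x2 + x3 - j = (x + x2 + x3 - (j - 1)) + (x + y - 1) - 3 * x" by simp
    then show ?thesis using dvd_diff[OF dvd_add[OF that(2,1)] dvd_triv_left[of 3 x]] by metis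
  qed
  show "bij_betw ?f (slice j) (slice (j - 1))"
  proof (rule bij_betw_byWitness[where f' = ?g])
    show "?f ` slice j \<subseteq> slice (j - 1)" unfolding slice_def using 1(1) 2 by force
    show "?g ` slice (j - 1) \<subseteq> slice j" unfolding slice_def using 1(2) 3 by force
  qed auto
qed (auto simp: triple_norm_def enorm_def power2_eq_square algebra_simps)

lemma theta_1_cubed:
  "borwein_c 1 * (borwein_c 1 * borwein_c 1) = 3 * gf triple_norm (slice 0)"
proof -
  have c: "3 dvd s - 0 \<or> 3 dvd s - 1 \<or> 3 dvd s - 2" for s :: int by presburger
  have U: "residue 1 \<times> residue 1 \<times> residue 1 = slice 0 \<union> (slice 1 \<union> slice 2)"
  proof (rule set_eqI)
    fix t :: "(int \<times> int) \<times> (int \<times> int) \<times> (int \<times> int)"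
    obtain x1 y1 x2 y2 x3 y3 where t: "t = ((x1, y1), (x2, y2), (x3, y3))" by (metis prod.exhaust)
    show "t \<in> residue 1 \<times> residue 1 \<times> residue 1 \<longleftrightarrow> t \<in> slice 0 \<union> (slice 1 \<union> slice 2)"
      unfolding t residue_def slice_def Un_iff mem_Sigma_iff mem_Collect_eq prod.case
      using c[of "x1 + x2 + x3"] by blast
  qed
  have disj: "slice i \<inter> slice j = {}" if "\<not> 3 dvd i - j" for i j
  proof -
    have "3 dvd i - j" if "3 dvd s - i" "3 dvd s - j" for s
      using dvd_diff[OF that(2,1)] by simp
    then show ?thesis using that unfolding slice_def by blast
  qed
  have "borwein_c 1 * (borwein_c 1 * borwein_c 1) = gf triple_norm (slice 0 \<union> (slice 1 \<union> slice 2))"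
    unfolding U[symmetric] gf_triple[symmetric] by (simp add: theta_def)
  also have "\<dots> = gf triple_norm (slice 0) + (gf triple_norm (slice 1) + gf triple_norm (slice 2))"
    by (subst gf_Un, rule graded_triple_norm, simp add: disj Int_Un_distrib)+ simp
  also have "\<dots> = 3 * gf triple_norm (slice 0)"
    using gf_slice_shift[of 1] gf_slice_shift[of 2] by simp
  finally show ?thesis .
qed

definition residue_sum_1 :: "((int \<times> int) \<times> (int \<times> int) \<times> (int \<times> int)) set" where
  "residue_sum_1 = {((a, b), (c, d), (e, f)). 3 dvd a + b + (c + d) + (e + f) - 1}"

text \<open>The bijection is the inverse Fourier transform
\<open>(t\<^sub>1 + t\<^sub>2 + t\<^sub>3, t\<^sub>1 + w\<^sup>2 t\<^sub>2 + w t\<^sub>3, t\<^sub>1 + w t\<^sub>2 + w\<^sup>2 t\<^sub>3)\<close>. It multiplies the sum of norms by 3, and all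
its components are congruent to \<open>t\<^sub>1 + t\<^sub>2 + t\<^sub>3\<close> modulo \<open>\<theta>\<close>.\<close>
lemma gf_slice_0: "gf triple_norm (slice 0) = gf (\<lambda>t. 3 * triple_norm t) residue_sum_1"
proof (rule sym, rule gf_bij)
  let ?F = "\<lambda>((a, b), (c, d), (e, f)).
    ((a + c + e, b + d + f), (a + (d - c) - f, b - c + (e - f)), (a - d + (f - e), b + (c - d) - e))"
  show "bij_betw ?F residue_sum_1 (slice 0)"
  proof (rule bij_betw_imageI)
    show "inj_on ?F residue_sum_1" by (auto simp: inj_on_def)
    show "?F ` residue_sum_1 = slice 0"
    proof
      show "?F ` residue_sum_1 \<subseteq> slice 0"
      proof clarify
        fix a b c d e f assume "((a, b), (c, d), (e, f)) \<in> residue_sum_1"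
        then obtain k where "a + b + (c + d) + (e + f) - 1 = 3 * k" by (auto simp: residue_sum_1_def)
        then have "(a + c + e) + (b + d + f) - 1 = 3 * k"
          "(a + (d - c) - f) + (b - c + (e - f)) - 1 = 3 * (k - c - f)"
          "(a - d + (f - e)) + (b + (c - d) - e) - 1 = 3 * (k - d - e)"
          "(a + c + e) + (a + (d - c) - f) + (a - d + (f - e)) - 0 = 3 * a" by auto
        then show "((a + c + e, b + d + f), (a + (d - c) - f, b - c + (e - f)), (a - d + (f - e), b + (c - d) - e)) \<in> slice 0"
          unfolding slice_def by (simp only: mem_Collect_eq prod.case dvd_triv_left simp_thms)
      qed
      show "slice 0 \<subseteq> ?F ` residue_sum_1"
      proof clarify
        fix x1 y1 x2 y2 x3 y3 assume "((x1, y1), (x2, y2), (x3, y3)) \<in> slice 0"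
        then obtain p1 p2 p3 q where "x1 + y1 - 1 = 3 * p1" "x2 + y2 - 1 = 3 * p2" "x3 + y3 - 1 = 3 * p3"
          "x1 + x2 + x3 - 0 = 3 * q" unfolding slice_def by (auto elim!: dvdE simp del: diff_zero diff_0_right)
        then have e: "y1 = 1 + 3 * p1 - x1" "y2 = 1 + 3 * p2 - x2" "y3 = 1 + 3 * p3 - x3"
          "x1 = 3 * q - x2 - x3" by auto
        \<comment> \<open>The components \<open>(u\<^sub>1 + u\<^sub>2 + u\<^sub>3)/3\<close>, \<open>(u\<^sub>1 + w u\<^sub>2 + w\<^sup>2 u\<^sub>3)/3\<close>, \<open>(u\<^sub>1 + w\<^sup>2 u\<^sub>2 + w u\<^sub>3)/3\<close> with the division carried out.\<close>
        let ?t = "((q, 1 + p1 + p2 + p3 - q), (q - x3 - p2 + p3, x2 - q + p1 - p2), (q - x2 + p2 - p3, x3 - q + p1 - p3))"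
        have "?t \<in> residue_sum_1" by (simp add: residue_sum_1_def)
        moreover have "((x1, y1), (x2, y2), (x3, y3)) = ?F ?t" by (simp add: e)
        ultimately show "((x1, y1), (x2, y2), (x3, y3)) \<in> ?F ` residue_sum_1" by (rule rev_image_eqI)
      qed
    qed
  qed
qed (auto simp: triple_norm_def enorm_def power2_eq_square algebra_simps)

text \<open>If three squares add up to 1 modulo 3, then exactly one of them is nonzero. With the condition on the
sum of the residues, the nonzero residue is 1.\<close>
lemma gf_residue_sum_1:
  assumes "m mod 3 = 1"
  shows "gf triple_norm residue_sum_1 $ m = 3 * (borwein_c 1 * (borwein_a 1 * borwein_a 1)) $ m"
proof -
  let ?W = "residue 1 \<times> residue 0 \<times> residue 0 \<union> (residue 0 \<times> residue 1 \<times> residue 0 \<union> residue 0 \<times> residue 0 \<times> residue 1)"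
  have "{t \<in> residue_sum_1. triple_norm t = int m} = {t \<in> ?W. triple_norm t = int m}"
  proof -
    have "t \<in> residue_sum_1 \<longleftrightarrow> t \<in> ?W" if t: "triple_norm t = int m" for t
    proof -
      obtain a b c d e f where abc: "t = ((a, b), (c, d), (e, f))" by (metis prod.exhaust)
      define u v w where "u = (a + b) mod 3" and "v = (c + d) mod 3" and "w = (e + f) mod 3"
      have "int m mod 3 = (enorm (a, b) mod 3 + (enorm (c, d) mod 3 + enorm (e, f) mod 3)) mod 3"
        unfolding t[symmetric] triple_norm_def abc prod.case by (intro mod_add_cong) simp_all
      moreover have "int m mod 3 = 1" using assms by presburger
      ultimately have "(u\<^sup>2 mod 3 + (v\<^sup>2 mod 3 + w\<^sup>2 mod 3)) mod 3 = 1"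
        unfolding enorm_mod_3 u_def v_def w_def by metis
      moreover have "t \<in> residue_sum_1 \<longleftrightarrow> (u + v + w) mod 3 = 1"
      proof -
        have "3 dvd s - 1 \<longleftrightarrow> s mod 3 = 1" for s :: int by presburger
        then have "t \<in> residue_sum_1 \<longleftrightarrow> (a + b + (c + d) + (e + f)) mod 3 = 1"
          unfolding residue_sum_1_def abc by blast
        also have "(a + b + (c + d) + (e + f)) mod 3 = (u + v + w) mod 3"
          unfolding u_def v_def w_def by (intro mod_add_cong) simp_all
        finally show ?thesis .
      qed
      moreover have "t \<in> ?W \<longleftrightarrow> u = 1 \<and> v = 0 \<and> w = 0 \<or> u = 0 \<and> v = 1 \<and> w = 0 \<or> u = 0 \<and> v = 0 \<and> w = 1"
        unfolding abc u_def v_def w_def by (simp add: residue_iff_mod)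
      moreover have "u = 0 \<or> u = 1 \<or> u = 2" "v = 0 \<or> v = 1 \<or> v = 2" "w = 0 \<or> w = 1 \<or> w = 2"
        unfolding u_def v_def w_def by presburger+
      ultimately show ?thesis by (elim disjE) simp_all
    qed
    then show ?thesis by blast
  qed
  then have "gf triple_norm residue_sum_1 $ m = gf triple_norm ?W $ m" by (simp only: gf_nth)
  also have "gf triple_norm ?W = borwein_c 1 * (borwein_a 1 * borwein_a 1) + (borwein_a 1 * (borwein_c 1 * borwein_a 1) + borwein_a 1 * (borwein_a 1 * borwein_c 1))"
    by (subst gf_Un, rule graded_triple_norm, force simp: residue_iff_mod)+ (simp add: theta_def gf_triple)
  also have "\<dots> = 3 * (borwein_c 1 * (borwein_a 1 * borwein_a 1))" by (simp add: mult.commute mult.left_commute)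
  also have "\<dots> $ m = 3 * (borwein_c 1 * (borwein_a 1 * borwein_a 1)) $ m" by (simp add: numeral_fps_const fps_mult_left_const_nth)
  finally show ?thesis .
qed

lemma theta_1_cubed_nth:
  assumes "m mod 3 = 1"
  shows "(borwein_c 1 * (borwein_c 1 * borwein_c 1)) $ (3 * m) = 9 * (borwein_c 1 * (borwein_a 1 * borwein_a 1)) $ m"
  using gf_residue_sum_1[OF assms] gf_scale[of 3 triple_norm residue_sum_1 m]
  by (simp add: theta_1_cubed gf_slice_0 numeral_fps_const fps_mult_left_const_nth del: One_nat_def)

section \<open>Bead sets of 3-cores\<close>

text \<open>The set of first-column hook lengths, built up from the last row. Adding a new first row leaves the
earlier beads in place, which makes induction over the list possible.\<close>
fun beads :: "nat list \<Rightarrow> nat set" where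
  "beads [] = {}"
| "beads (x # q) = insert (x + length q) (beads q)"

definition column :: "nat list \<Rightarrow> nat \<Rightarrow> nat" where
  "column q j = length (filter (\<lambda>y. j < y) q)"

lemma column_le: "column q j \<le> length q"
  by (simp add: column_def)

lemma column_card: "column q j = card {k. (k, j) \<in> young_cells q}"
  by (simp add: column_def length_filter_conv_card young_cells_def)

lemma hook_number_first_row:
  assumes "j < x"
  shows "hook_number (x # q) (0, j) = x - j + column q j"
proof -
  have "{l. j < l \<and> (0, l) \<in> young_cells (x # q)} = {j<..<x}"
    by (auto simp: young_cells_def)
  moreover have "{k. 0 < k \<and> (k, j) \<in> young_cells (x # q)} = Suc ` {k. (k, j) \<in> young_cells q}"
    by (force simp: young_cells_def gr0_conv_Suc image_iff)
  ultimately show ?thesis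
    using assms by (simp add: hook_number_def column_card card_image)
qed

lemma hook_number_lower_rows: "hook_number (x # q) (Suc i, j) = hook_number q (i, j)"
proof -
  have "{k. Suc i < k \<and> (k, j) \<in> young_cells (x # q)} = Suc ` {k. i < k \<and> (k, j) \<in> young_cells q}"
    by (auto simp: young_cells_def image_iff less_Suc_eq_0_disj Suc_less_eq2)
  then show ?thesis
    by (simp add: hook_number_def card_image) (simp add: young_cells_def)
qed

lemma is_partition_Cons:
  "is_partition (x # q) \<longleftrightarrow> is_partition q \<and> 0 < x \<and> (\<forall>y\<in>set q. y \<le> x)"
  by (auto simp: is_partition_def)

text \<open>The boundary of the Young diagram, followed from its bottom left corner, has a vertical step at every
bead; its horizontal step below column \<open>j\<close> is at position \<open>gap q j\<close>. Every position carries just one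
step, so the gaps are the numbers that are not beads.\<close>
definition gap :: "nat list \<Rightarrow> nat \<Rightarrow> nat" where
  "gap q j = length q + j - column q j"

lemma range_gap: "is_partition q \<Longrightarrow> range (gap q) = - beads q"
proof (induction q)
  case Nil
  then show ?case by (auto simp: gap_def column_def)
next
  case (Cons y q)
  have p: "is_partition q" "\<forall>z\<in>set q. z \<le> y" using Cons.prems by (auto simp: is_partition_Cons)
  have lo: "gap (y # q) j = gap q j" "gap q j < y + length q" if "j < y" for j
    using that by (auto simp: gap_def column_def)
  have col: "column q j = 0" if "y \<le> j" for j
    using that p(2) by (auto simp: column_def filter_empty_conv)
  have hi: "gap (y # q) j = Suc (length q + j)" "gap q j = length q + j" if "y \<le> j" for j
    using that col[OF that] by (auto simp: gap_def column_def)
  have "range (gap (y # q)) = range (gap q) - {y + length q}"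
  proof (intro equalityI subsetI)
    fix g assume "g \<in> range (gap (y # q))"
    then obtain j where j: "g = gap (y # q) j" by auto
    show "g \<in> range (gap q) - {y + length q}"
    proof (cases "j < y")
      case True
      then show ?thesis using lo[OF True] j by auto
    next
      case False
      then have "g = gap q (Suc j)" "g \<noteq> y + length q" using hi(1)[of j] hi(2)[of "Suc j"] j by auto
      then show ?thesis by auto
    qed
  next
    fix g assume "g \<in> range (gap q) - {y + length q}"
    then obtain j where j: "g = gap q j" "g \<noteq> y + length q" by auto
    show "g \<in> range (gap (y # q))"
    proof (cases "j < y")
      case True
      then show ?thesis using lo(1)[OF True] j by (metis rangeI)
    next
      case False
      then have "y < j" using j hi(2)[of j] by (cases "j = y") auto
      then have "g = gap (y # q) (j - 1)" using hi(1)[of "j - 1"] hi(2)[of j] j by auto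
      then show ?thesis by auto
    qed
  qed
  then show ?case using Cons.IH[OF p(1)] by auto
qed

lemma parts_le_iff:
  assumes "is_partition q"
  shows "(\<forall>y\<in>set q. y \<le> x) \<longleftrightarrow> (\<forall>s\<in>beads q. s < x + length q)"
  using assms
proof (induction q arbitrary: x)
  case (Cons y q)
  then have "\<forall>s\<in>beads q. s < y + length q" by (auto simp: is_partition_Cons)
  then show ?case using Cons.prems by (auto simp: is_partition_Cons)
qed simp

text \<open>The hook of the cell in column \<open>j\<close> of the first row is the distance from the first row's bead to the gap
of that column. Hence no hook length in this row is a multiple of \<open>t\<close> if and only if every position that lies
below the first bead by a multiple of \<open>t\<close> is a bead.\<close>
lemma is_core_Cons:
  "is_core t (x # q) \<longleftrightarrow> is_core t q \<and> 0 < x \<and> (\<forall>s\<in>beads q. s < x + length q)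
    \<and> (\<forall>g < x + length q. t dvd x + length q - g \<longrightarrow> g \<in> beads q)"
proof -
  have cells: "young_cells (x # q) = Pair 0 ` {..<x} \<union> (\<lambda>(i, j). (Suc i, j)) ` young_cells q"
  proof (rule set_eqI)
    fix c show "c \<in> young_cells (x # q) \<longleftrightarrow> c \<in> Pair 0 ` {..<x} \<union> (\<lambda>(i, j). (Suc i, j)) ` young_cells q"
      by (cases c; cases "fst c") (auto simp: young_cells_def image_iff)
  qed
  have row: "(\<forall>j<x. \<not> t dvd hook_number (x # q) (0, j)) \<longleftrightarrow>
      (\<forall>g < x + length q. t dvd x + length q - g \<longrightarrow> g \<in> beads q)"
    if q: "is_partition q" "\<forall>y\<in>set q. y \<le> x"
  proof -
    have hook: "hook_number (x # q) (0, j) = x + length q - gap q j" if "j < x" for j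
      using hook_number_first_row[OF that, of q] column_le[of q j] that by (simp add: gap_def)
    have less: "gap q j < x + length q \<longleftrightarrow> j < x" for j
    proof (cases "j < x")
      case False
      then have "column q j = 0" using q(2) by (auto simp: column_def filter_empty_conv)
      then show ?thesis using False by (simp add: gap_def)
    qed (simp add: gap_def)
    have "(\<forall>j<x. \<not> t dvd hook_number (x # q) (0, j)) \<longleftrightarrow>
        (\<forall>j. gap q j < x + length q \<longrightarrow> \<not> t dvd x + length q - gap q j)"
      using less hook by auto
    also have "\<dots> \<longleftrightarrow> (\<forall>g\<in>range (gap q). g < x + length q \<longrightarrow> \<not> t dvd x + length q - g)" by auto
    also have "\<dots> \<longleftrightarrow> (\<forall>g < x + length q. t dvd x + length q - g \<longrightarrow> g \<in> beads q)"
      unfolding range_gap[OF q(1)] by auto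
    finally show ?thesis .
  qed
  have "is_core t (x # q) \<longleftrightarrow> is_partition (x # q) \<and> (\<forall>j<x. \<not> t dvd hook_number (x # q) (0, j))
      \<and> (\<forall>c\<in>young_cells q. \<not> t dvd hook_number q c)"
    unfolding is_core_def cells by (auto simp: hook_number_lower_rows ball_Un)
  then show ?thesis using row parts_le_iff[of q x] by (auto simp: is_core_def is_partition_Cons)
qed

text \<open>The beads on an abacus with three runners: \<open>a\<close> beads pushed down on runner 1 and \<open>b\<close> beads on runner 2.
Runner 0 is empty, as position 0 is not a first-column hook length.\<close>
definition runners :: "nat \<Rightarrow> nat \<Rightarrow> nat set" where
  "runners a b = (\<lambda>i. 3 * i + 1) ` {..<a} \<union> (\<lambda>i. 3 * i + 2) ` {..<b}"

lemma mem_runners: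
  "s \<in> runners a b \<longleftrightarrow> s mod 3 = 1 \<and> s div 3 < a \<or> s mod 3 = 2 \<and> s div 3 < b"
proof
  have "(3 * i + 1) mod 3 = 1" "(3 * i + 1) div 3 = i" "(3 * i + 2) mod 3 = 2" "(3 * i + 2) div 3 = i" for i :: nat
    by presburger+
  then show "s \<in> runners a b \<Longrightarrow> s mod 3 = 1 \<and> s div 3 < a \<or> s mod 3 = 2 \<and> s div 3 < b"
    unfolding runners_def by (elim UnE imageE) (simp_all only: lessThan_iff simp_thms)
next
  assume "s mod 3 = 1 \<and> s div 3 < a \<or> s mod 3 = 2 \<and> s div 3 < b"
  moreover have "s = 3 * (s div 3) + 1" if "s mod 3 = 1" using that by presburger
  moreover have "s = 3 * (s div 3) + 2" if "s mod 3 = 2" using that by presburger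
  ultimately show "s \<in> runners a b" unfolding runners_def by blast
qed

lemma nth_bead_iff:
  fixes i a b :: nat
  shows "3 * i + 1 \<in> runners a b \<longleftrightarrow> i < a" and "3 * i + 2 \<in> runners a b \<longleftrightarrow> i < b"
proof -
  have "(3 * i + 1) mod 3 = 1" "(3 * i + 1) div 3 = i" "(3 * i + 2) mod 3 = 2" "(3 * i + 2) div 3 = i" by presburger+
  then show "3 * i + 1 \<in> runners a b \<longleftrightarrow> i < a" "3 * i + 2 \<in> runners a b \<longleftrightarrow> i < b"
    unfolding mem_runners by auto
qed

text \<open>The largest of the beads \<open>runners a b\<close> belongs to the first row. It is \<open>3 a - 2\<close> if \<open>b < a\<close>, and
\<open>3 b - 1\<close> otherwise; the part is the bead minus the number \<open>a + b - 1\<close> of the remaining rows.\<close>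
function core3 :: "nat \<Rightarrow> nat \<Rightarrow> nat list" where
  "core3 a b = (if a = 0 \<and> b = 0 then []
    else if b < a then (2 * a - b - 1) # core3 (a - 1) b
    else (2 * b - a) # core3 a (b - 1))"
  by auto
termination by (relation "measure (\<lambda>(a, b). a + b)") auto

declare core3.simps [simp del]

lemma core3_0 [simp]: "core3 0 0 = []" by (simp add: core3.simps)

lemma core3_Suc_left: "b \<le> a \<Longrightarrow> core3 (Suc a) b = (2 * a + 1 - b) # core3 a b"
  by (subst core3.simps) simp

lemma core3_Suc_right: "a \<le> Suc b \<Longrightarrow> core3 a (Suc b) = (2 * b + 2 - a) # core3 a b"
  by (subst core3.simps) simp

lemma core3_induct [case_names empty left right]:
  assumes "P 0 0" "\<And>a b. b \<le> a \<Longrightarrow> P a b \<Longrightarrow> P (Suc a) b" "\<And>a b. a \<le> Suc b \<Longrightarrow> P a b \<Longrightarrow> P a (Suc b)"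
  shows "P a b"
proof (induction a b rule: core3.induct)
  case (1 a b)
  consider "a = 0" "b = 0" | a' where "a = Suc a'" "b \<le> a'" | b' where "b = Suc b'" "a \<le> Suc b'"
    by (cases a; cases b) (auto simp: not_le less_Suc_eq_le, meson not_less_eq_eq)
  then show ?case
  proof cases
    case 1 then show ?thesis using assms(1) by simp
  next
    case 2 then show ?thesis using "1.IH"(1) assms(2) by auto
  next
    case 3 then show ?thesis using "1.IH"(2) assms(3) by auto
  qed
qed

lemma length_core3: "length (core3 a b) = a + b"
  by (induction a b rule: core3_induct) (auto simp: core3_Suc_left core3_Suc_right)

lemma beads_core3: "beads (core3 a b) = runners a b"
  by (induction a b rule: core3_induct)
     (auto simp: core3_Suc_left core3_Suc_right length_core3 runners_def lessThan_Suc)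

lemma core3_inject: "core3 a b = core3 a' b' \<Longrightarrow> a = a' \<and> b = b'"
proof -
  assume "core3 a b = core3 a' b'"
  then have eq: "runners a b = runners a' b'" by (metis beads_core3)
  have "i < a \<longleftrightarrow> i < a'" "i < b \<longleftrightarrow> i < b'" for i
    using nth_bead_iff[of i a b] nth_bead_iff[of i a' b'] unfolding eq by blast+
  then show ?thesis by (metis linorder_neq_iff)
qed

lemma is_core_core3: "is_core 3 (core3 a b)"
proof (induction a b rule: core3_induct)
  case empty
  show ?case by (simp add: is_core_def is_partition_def young_cells_def)
next
  case (left a b)
  have X: "2 * a + 1 - b + (a + b) = 3 * a + 1" using left by simp
  have "s < 3 * a + 1" if "s \<in> runners a b" for s using that left by (auto simp: runners_def)
  moreover have "g \<in> runners a b" if "g < 3 * a + 1" "3 dvd 3 * a + 1 - g" for g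
    using that unfolding mem_runners by presburger
  ultimately show ?case
    using left by (auto simp: core3_Suc_left is_core_Cons length_core3 beads_core3 X)
next
  case (right a b)
  have X: "2 * b + 2 - a + (a + b) = 3 * b + 2" using right by simp
  have "s < 3 * b + 2" if "s \<in> runners a b" for s using that right by (auto simp: runners_def)
  moreover have "g \<in> runners a b" if "g < 3 * b + 2" "3 dvd 3 * b + 2 - g" for g
    using that unfolding mem_runners by presburger
  ultimately show ?case
    using right by (auto simp: core3_Suc_right is_core_Cons length_core3 beads_core3 X)
qed

text \<open>By induction the rows below the first have beads \<open>runners a b\<close>. The bead \<open>X\<close> of the first row is not a
multiple of 3, as 0 would then have to be a bead. It lies above all other beads, and the positions
\<open>X - 3, X - 6, \<dots>\<close> are occupied, so it is the next free position on its runner.\<close>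
lemma is_core_3_imp: "is_core 3 p \<Longrightarrow> \<exists>a b. p = core3 a b"
proof (induction p)
  case Nil
  show ?case by (metis core3_0)
next
  case (Cons x q)
  then obtain a b where q: "q = core3 a b" by (auto simp: is_core_Cons)
  define X where "X = x + (a + b)"
  have x: "0 < x" and less: "\<And>s. s \<in> runners a b \<Longrightarrow> s < X"
    and closed: "\<And>g. g < X \<Longrightarrow> 3 dvd X - g \<Longrightarrow> g \<in> runners a b"
    using Cons.prems by (auto simp: is_core_Cons q length_core3 beads_core3 X_def)
  have "X mod 3 \<noteq> 0"
    using closed[of 0] x by (auto simp: X_def mem_runners dvd_eq_mod_eq_0)
  then have "X = 3 * (X div 3) + 1 \<or> X = 3 * (X div 3) + 2" by presburger
  then consider k where "X = 3 * k + 1" | k where "X = 3 * k + 2" by blast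
  then show ?case
  proof cases
    case (1 k)
    have "a \<le> k" using less[unfolded 1, OF nth_bead_iff(1)[THEN iffD2, of "a - 1" a b]] by (cases a) auto
    moreover have "k \<le> a" using closed[of "3 * (k - 1) + 1"] nth_bead_iff(1)[of "k - 1" a b] 1 by (cases k) auto
    moreover have "b \<le> k" using less[unfolded 1, OF nth_bead_iff(2)[THEN iffD2, of "b - 1" b a]] by (cases b) auto
    ultimately have "b \<le> a" "x = 2 * a + 1 - b" using 1 by (auto simp: X_def)
    then have "x # q = core3 (Suc a) b" by (simp add: q core3_Suc_left)
    then show ?thesis by blast
  next
    case (2 k)
    have "b \<le> k" using less[unfolded 2, OF nth_bead_iff(2)[THEN iffD2, of "b - 1" b a]] by (cases b) auto
    moreover have "k \<le> b" using closed[of "3 * (k - 1) + 2"] nth_bead_iff(2)[of "k - 1" a b] 2 by (cases k) auto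
    moreover have "a \<le> Suc k" using less[unfolded 2, OF nth_bead_iff(1)[THEN iffD2, of "a - 1" a b]] by (cases a) auto
    ultimately have "a \<le> Suc b" "x = 2 * b + 2 - a" using 2 by (auto simp: X_def)
    then have "x # q = core3 a (Suc b)" by (simp add: q core3_Suc_right)
    then show ?thesis by blast
  qed
qed

section \<open>Three-cores as Eisenstein integers\<close>

definition core_size :: "int \<times> int \<Rightarrow> int" where
  "core_size = (\<lambda>(a, b). a\<^sup>2 - a * b + b\<^sup>2 + b)"

lemma sum_list_core3: "int (sum_list (core3 a b)) = core_size (int a, int b)"
  by (induction a b rule: core3_induct)
     (auto simp: core3_Suc_left core3_Suc_right core_size_def of_nat_diff power2_eq_square algebra_simps)

text \<open>Multiplication by \<open>w\<close> on the coset \<open>1 + \<theta> \<int>[w]\<close>, in the coordinates \<open>(a, b) \<mapsto> 1 - \<theta> (a + b w)\<close>.\<close>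
definition core_orbit :: "int \<times> int \<Rightarrow> int \<times> int" where
  "core_orbit = (\<lambda>(a, b). (- 1 - b, a - b - 1))"

lemma core_size_orbit: "core_size (core_orbit z) = core_size z"
  by (cases z) (simp add: core_size_def core_orbit_def power2_eq_square algebra_simps)

lemma core_size_nonneg: "0 \<le> 3 * core_size z + 1"
  and enorm_eq_core_size: "enorm (1 - fst z + 2 * snd z, snd z - 2 * fst z) = 3 * core_size z + 1"
proof -
  show "enorm (1 - fst z + 2 * snd z, snd z - 2 * fst z) = 3 * core_size z + 1"
    by (cases z) (simp add: core_size_def enorm_def power2_eq_square algebra_simps)
  then show "0 \<le> 3 * core_size z + 1" by (metis enorm_nonneg)
qed

definition quadrant :: "(int \<times> int) set" where "quadrant = {(a, b). 0 \<le> a \<and> 0 \<le> b}"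

lemma bij_coset:
  "bij_betw (\<lambda>z. (1 - fst z + 2 * snd z, snd z - 2 * fst z)) UNIV (residue 1)"
proof (rule bij_betw_imageI)
  show "inj (\<lambda>z. (1 - fst z + 2 * snd z, snd z - 2 * fst z :: int))"
    by (auto simp: inj_on_def prod_eq_iff)
  show "range (\<lambda>z. (1 - fst z + 2 * snd z, snd z - 2 * fst z)) = residue 1"
  proof (intro equalityI subsetI)
    fix w assume "w \<in> residue 1"
    then obtain x y t where w: "w = (x, y)" "x + y - 1 = 3 * t" by (auto simp: residue_def)
    then have "w = (\<lambda>z. (1 - fst z + 2 * snd z, snd z - 2 * fst z)) (t - y, 2 * t - y)" by simp
    then show "w \<in> range (\<lambda>z. (1 - fst z + 2 * snd z, snd z - 2 * fst z))" by blast
  next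
    fix w assume "w \<in> range (\<lambda>z. (1 - fst z + 2 * snd z, snd z - 2 * fst z :: int))"
    then obtain a b where "w = (1 - a + 2 * b, b - 2 * a)" by auto
    moreover have "(1 - a + 2 * b) + (b - 2 * a) - 1 = 3 * (b - a)" by simp
    ultimately show "w \<in> residue 1" unfolding residue_def by (metis (mono_tags, lifting) dvd_triv_left mem_Collect_eq prod.case)
  qed
qed

lemma graded_core_size: "graded (\<lambda>z. 3 * core_size z + 1) S"
proof (rule graded_subset[of _ UNIV])
  let ?f = "\<lambda>z. (1 - fst z + 2 * snd z, snd z - 2 * fst z)"
  have "finite {z. 3 * core_size z + 1 = n}" for n
  proof -
    have "finite {w \<in> UNIV. int 1 * enorm w = n}"
      using graded_enorm[of 1 UNIV] unfolding graded_def by simp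
    then have "finite (?f -` {w. enorm w = n})"
      using bij_coset by (intro finite_vimageI) (auto simp: bij_betw_def)
    moreover have "?f -` {w. enorm w = n} = {z. 3 * core_size z + 1 = n}"
      by (auto simp: enorm_eq_core_size)
    ultimately show ?thesis by simp
  qed
  then show "graded (\<lambda>z. 3 * core_size z + 1) UNIV" by (auto simp: graded_def core_size_nonneg)
qed auto

text \<open>The quadrant is a fundamental domain for the rotation of order 3: it and its two images \<open>S1\<close> and \<open>S2\<close>
partition the plane.\<close>
lemma theta_1_eq_cores: "theta 1 1 = 3 * gf (\<lambda>z. 3 * core_size z + 1) quadrant"
proof -
  let ?w = "\<lambda>z. 3 * core_size z + 1"
  define S1 S2 where "S1 = {(a, b). a < (0::int) \<and> a \<le> b}" and "S2 = {(a, b). b < (0::int) \<and> b < a}"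
  have orbit1: "gf ?w quadrant = gf ?w S1"
  proof (rule gf_bij)
    show "bij_betw core_orbit quadrant S1"
      by (rule bij_betw_byWitness[where f' = "\<lambda>(a, b). (b - a, - 1 - a)"])
         (auto simp: core_orbit_def quadrant_def S1_def)
  qed (simp add: core_size_orbit)
  have orbit2: "gf ?w S1 = gf ?w S2"
  proof (rule gf_bij)
    show "bij_betw core_orbit S1 S2"
      by (rule bij_betw_byWitness[where f' = "\<lambda>(a, b). (b - a, - 1 - a)"])
         (auto simp: core_orbit_def S1_def S2_def)
  qed (simp add: core_size_orbit)
  have "theta 1 1 = gf enorm (residue 1)" by (simp add: theta_def)
  also have "\<dots> = gf ?w UNIV"
    by (rule sym, rule gf_bij[OF bij_coset]) (rule enorm_eq_core_size)
  also have "UNIV = quadrant \<union> (S1 \<union> S2)" by (auto simp: quadrant_def S1_def S2_def)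
  also have "gf ?w \<dots> = gf ?w quadrant + (gf ?w S1 + gf ?w S2)"
    by (subst gf_Un, rule graded_core_size, force simp: quadrant_def S1_def S2_def)+ simp
  finally show ?thesis using orbit1 orbit2 by simp
qed

lemma bij_core3: "bij_betw (\<lambda>(a, b). core3 (nat a) (nat b)) quadrant {p. is_core 3 p}"
proof (rule bij_betw_imageI)
  show "inj_on (\<lambda>(a, b). core3 (nat a) (nat b)) quadrant"
    by (auto simp: inj_on_def quadrant_def dest!: core3_inject)
  show "(\<lambda>(a, b). core3 (nat a) (nat b)) ` quadrant = {p. is_core 3 p}"
  proof (intro equalityI subsetI)
    fix p assume "p \<in> {p. is_core 3 p}"
    then obtain a b where "p = core3 a b" using is_core_3_imp by blast
    then have "p = (\<lambda>(a, b). core3 (nat a) (nat b)) (int a, int b)" "(int a, int b) \<in> quadrant"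
      by (auto simp: quadrant_def)
    then show "p \<in> (\<lambda>(a, b). core3 (nat a) (nat b)) ` quadrant" by blast
  qed (auto simp: is_core_core3)
qed

lemma gf_quadrant_eq_cores:
  "gf (\<lambda>z. 3 * core_size z + 1) quadrant
    = gf (\<lambda>p. 3 * int (sum_list p) + 1) {p. is_core 3 p}"
  by (rule gf_bij[OF bij_core3]) (auto simp: sum_list_core3 quadrant_def)

lemma graded_cores: "graded (\<lambda>p. 3 * int (sum_list p) + 1) {p. is_core 3 p}"
proof -
  have "finite {p. is_core 3 p \<and> 3 * int (sum_list p) + 1 = n}" for n
    by (rule finite_subset[OF _ finite_partitions_le[of "nat n"]]) (auto simp: is_core_def)
  then show ?thesis by (auto simp: graded_def)
qed

text \<open>Three cores of sizes adding up to \<open>n\<close> contribute the exponent \<open>3 n + 3\<close>, and each of the three factors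
\<open>c\<close> counts every core 3 times.\<close>
lemma theta_1_cubed_cores:
  "(borwein_c 1 * (borwein_c 1 * borwein_c 1)) $ (3 * n + 3) = 27 * int (B3 n)"
proof -
  let ?w = "\<lambda>p. 3 * int (sum_list p) + 1" and ?P = "{p. is_core 3 p}"
  have "{t \<in> ?P \<times> ?P \<times> ?P. (case t of (p, q, r) \<Rightarrow> ?w p + (?w q + ?w r)) = int (3 * n + 3)}
      = {(p, q, r). is_core 3 p \<and> is_core 3 q \<and> is_core 3 r \<and> sum_list p + sum_list q + sum_list r = n}"
    by auto
  then have "(gf ?w ?P * (gf ?w ?P * gf ?w ?P)) $ (3 * n + 3) = int (B3 n)"
    unfolding gf3[OF graded_cores graded_cores graded_cores] gf_nth B3_def by simp
  moreover have "borwein_c 1 * (borwein_c 1 * borwein_c 1) = 27 * (gf ?w ?P * (gf ?w ?P * gf ?w ?P))"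
    unfolding theta_1_eq_cores gf_quadrant_eq_cores by (simp add: algebra_simps)
  ultimately show ?thesis by (simp add: numeral_fps_const fps_mult_left_const_nth)
qed

theorem theorem2p7:
  fixes n :: nat
  shows "omega (12 * n + 2) = 12 * B3 (6 * n)"
proof -
  define m where "m = 6 * n + 1"
  have m: "odd m" "m mod 3 = 1" "12 * n + 2 = 2 * m" "3 * m = 3 * (6 * n) + 3"
    unfolding m_def by (auto simp: mod_simps) presburger+
  have "int (omega (12 * n + 2)) = 4 * (borwein_c 1 * (borwein_a 1 * borwein_a 1)) $ m"
    unfolding m(3) by (rule omega_eq_caa[OF m(1,2)])
  moreover have "9 * (borwein_c 1 * (borwein_a 1 * borwein_a 1)) $ m = 27 * int (B3 (6 * n))"
    using theta_1_cubed_nth[OF m(2)] theta_1_cubed_cores[of "6 * n"] unfolding m(4) by simp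
  ultimately show ?thesis by linarith
qed

end
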